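(* Assume $\mathcal R$ is discrete and mixed-binary-linear representable. There is $M_0$ such that for every constant $M\ge M_0$ ("big-$M$" constant), the finite program (F) given in the context is equivalent to the following mixed-binary linear program: maximize $\tau$ over $\tau\in\mathbb R$; $v^\kappa,w^\kappa\in\{0,1\}^I$ ($\kappa\in\mathcal K$); $\alpha^s\in\mathbb R_+^K$, $\beta^s\in\mathbb R_+^N$, $\mu^s\in\mathbb R_-$, $x^s\in\mathcal R$ ($s\in\{-1,1\}^K$); $\overline v^{s\kappa},\overline w^{s\kappa}\in\mathbb R_+^I$ ($s\in\{-1,1\}^K,\kappa\in\mathcal K$), subject to (1) for all $s\in\{-1,1\}^K$: $\tau\le b^\top\beta^s+\Gamma\mu^s$, $\ \sum_{i=1}^I x^i\sum_{\kappa\in\mathcal K}s_\kappa(\overline v^{s\kappa}_i-\overline w^{s\kappa}_i)+B^\top\beta^s=x^s$, $\ \alpha^s+\mu^s\mathbf 1\le 0$; (2) for all $\kappa\in\mathcal K$: $\mathbf 1^\top v^\kappa=1$, $\mathbf 1^\top w^\kappa=1$, and $1-w_i^\kappa\ge\sum_{i'\ge i}v^\kappa_{i'}$ for all $i\in\{1,\dots,I\}$; (3) for all $s\in\{-1,1\}^K,\kappa\in\mathcal K$: $\overline v^{s\kappa}\le Mv^\kappa$, $\overline v^{s\kappa}\le\alpha^s_\kappa\mathbf 1$, $\overline v^{s\kappa}\ge\alpha^s_\kappa\mathbf 1-M(\mathbf 1-v^\kappa)$, and $\overline w^{s\kappa}\le Mw^\kappa$, $\overline w^{s\kappa}\le\alpha^s_\kappa\mathbf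 1$, $\overline w^{s\kappa}\ge\alpha^s_\kappa\mathbf 1-M(\mathbf 1-w^\kappa)$. Moreover, given an optimal solution to this mixed-binary linear program, an optimal set of queries for the offline max-min utility elicitation problem (QP) given in the context is $$\iota_1^\kappa=\sum_{i=1}^I i\cdot\mathbb I(v_i^\kappa=1),\qquad \iota_2^\kappa=\sum_{i=1}^I i\cdot\mathbb I(w_i^\kappa=1),\qquad\kappa\in\mathcal K.$$
   Context: Data: integers $I\ge 2$, $J,K\ge 1$; items $x^1,\dots,x^I\in\mathbb R^J$; a recommendation set $\mathcal R\subseteq\mathbb R^J$; $\mathcal U^0=\{u\in\mathbb R^J:Bu\ge b\}$ with $B\in\mathbb R^{N\times J}$, $b\in\mathbb R^N$, non-empty, full-dimensional and bounded; $\Gamma\ge 0$. $\mathcal R$ is mixed-binary-linear representable if it is the projection onto the $x$-coordinates of a set of vectors $(x,y,z)$ satisfying finitely many linear inequalities with $y$ real and $z$ binary. Notation: $\mathcal K=\{1,\dots,K\}$; $\mathcal C=\{(i,i'):1\le i<i'\le I\}$; $\iota=(\iota^\kappa)_{\kappa\in\mathcal K}\in\mathcal C^K$, $\iota^\kappa=(\iota^\kappa_1,\iota^\kappa_2)$; $\mathcal E_\Gamma=\{\epsilon\in\mathbb R_+^K:\sum_\kappa\epsilon_\kappa\le\Gamma\}$; $\mathbf 1$ is the all-ones vector; vector inequalities are componentwise; $\mathbb I(E)=1$ if $E$ is true, $0$ otherwise. Finite program (F): maximize $\tau$ over $\tau\in\mathbb R$, $\iota\in\mathcal C^K$, and, for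 every $s\in\{-1,1\}^K$, $x^s\in\mathcal R$, $\alpha^s\in\mathbb R_+^K$, $\beta^s\in\mathbb R_+^N$, $\mu^s\in\mathbb R_-$, subject to, for every $s\in\{-1,1\}^K$, $$\tau\le b^\top\beta^s+\Gamma\mu^s,\qquad \sum_{\kappa\in\mathcal K}s_\kappa(x^{\iota^\kappa_1}-x^{\iota^\kappa_2})\alpha^s_\kappa+B^\top\beta^s=x^s,\qquad \alpha^s+\mu^s\mathbf 1\le 0 .$$ Problem (QP): for $s\in\{-1,0,1\}^K$ let $$\mathcal U_\Gamma(\iota,s)=\Big\{u\in\mathcal U^0:\exists\epsilon\in\mathcal E_\Gamma\text{ with }u^\top d^\kappa>-\epsilon_\kappa\ \forall\kappa:s_\kappa=1;\ |u^\top d^\kappa|\le\epsilon_\kappa\ \forall\kappa:s_\kappa=0;\ u^\top d^\kappa<\epsilon_\kappa\ \forall\kappa:s_\kappa=-1\Big\},$$ with $d^\kappa=x^{\iota_1^\kappa}-x^{\iota_2^\kappa}$, and $\mathcal S_\Gamma(\iota)=\{s\in\{-1,0,1\}^K:\mathcal U_\Gamma(\iota,s)\ne\emptyset\}$. Then (QP) is $$\max_{\iota\in\mathcal C^K}\ \min_{s\in\mathcal S_\Gamma(\iota)}\ \max_{x\in\mathcal R}\ \min_{u\in\mathcal U_\Gamma(\iota,s)}u^\top x .$$ Conventions: $\max,\min$ denote suprema/infima in the extended reals. "Equivalent" means: same optimal value and same set of optimal queries, where $\iota\in\mathcal C^K$ is optimal if the optimal value with the queries fixed to $\iota$ equals the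 overall optimal value; in the mixed-binary linear program, $(v,w)$ encodes $\iota$ by the displayed formulas. *)

theory Defs
  imports "HOL-Analysis.Analysis"
begin

text \<open>The index types \<open>'j\<close>, \<open>'n\<close>, \<open>'k\<close> stand for the coordinates \<open>1..J\<close>, the rows \<open>1..N\<close> of \<open>B\<close> and
  the query positions \<open>1..K\<close>. Items are indexed by natural numbers, because their order matters;
  only the values of \<open>x\<close> on \<open>{1..I}\<close> are ever used. The order on vectors is componentwise and
  \<open>1\<close> is the all-ones vector.\<close>

text \<open>In the following definition \<open>p\<close>, \<open>q\<close> and \<open>m\<close> are the numbers of real variables, binary variables
  and inequalities.\<close>

definition mixed_binary_linear_representable :: "(real ^ 'j) set \<Rightarrow> bool" where
  "mixed_binary_linear_representable R \<longleftrightarrow>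
     (\<exists>(p::nat) (q::nat) (m::nat) (A :: nat \<Rightarrow> real ^ 'j) (C :: nat \<Rightarrow> nat \<Rightarrow> real)
        (D :: nat \<Rightarrow> nat \<Rightarrow> real) (c :: nat \<Rightarrow> real).
        R = {x. \<exists>(y :: nat \<Rightarrow> real) (z :: nat \<Rightarrow> real).
                  (\<forall>l<q. z l \<in> {0, 1}) \<and>
                  (\<forall>r<m. A r \<bullet> x + (\<Sum>l<p. C r l * y l) + (\<Sum>l<q. D r l * z l) \<ge> c r)})"

definition utility_set :: "real ^ 'j ^ 'n \<Rightarrow> real ^ 'n \<Rightarrow> (real ^ 'j) set" where
  "utility_set B b = {u. B *v u \<ge> b}"

definition comparisons :: "nat \<Rightarrow> (nat \<times> nat) set" where
  "comparisons I = {(i, i'). 1 \<le> i \<and> i < i' \<and> i' \<le> I}"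

definition queries :: "nat \<Rightarrow> ('k \<Rightarrow> nat \<times> nat) set" where
  "queries I = {\<iota>. \<forall>\<kappa>. \<iota> \<kappa> \<in> comparisons I}"

definition query_diff :: "(nat \<Rightarrow> real ^ 'j) \<Rightarrow> ('k \<Rightarrow> nat \<times> nat) \<Rightarrow> 'k \<Rightarrow> real ^ 'j" where
  "query_diff x \<iota> \<kappa> = x (fst (\<iota> \<kappa>)) - x (snd (\<iota> \<kappa>))"

definition noise_set :: "real \<Rightarrow> (real ^ 'k) set" where
  "noise_set \<Gamma> = {\<epsilon>. \<epsilon> \<ge> 0 \<and> (\<Sum>\<kappa>\<in>UNIV. \<epsilon> $ \<kappa>) \<le> \<Gamma>}"

definition sign_vectors :: "(real ^ 'k) set" where
  "sign_vectors = {s. \<forall>\<kappa>. s $ \<kappa> \<in> {-1, 1}}"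

definition sign_zero_vectors :: "(real ^ 'k) set" where
  "sign_zero_vectors = {s. \<forall>\<kappa>. s $ \<kappa> \<in> {-1, 0, 1}}"

text \<open>Given the objective value \<open>val \<iota>\<close> obtained with the queries fixed to \<open>\<iota>\<close> and the overall optimal
  value \<open>opt\<close>, the optimal queries among all admissible ones are the following.\<close>

definition optimal_queries ::
    "nat \<Rightarrow> (('k \<Rightarrow> nat \<times> nat) \<Rightarrow> ereal) \<Rightarrow> ereal \<Rightarrow> ('k \<Rightarrow> nat \<times> nat) set" where
  "optimal_queries I val opt = {\<iota> \<in> queries I. val \<iota> = opt}"


section \<open>The offline max-min utility elicitation problem\<close>

definition response_utilities ::
    "(nat \<Rightarrow> real ^ 'j) \<Rightarrow> real ^ 'j ^ 'n \<Rightarrow> real ^ 'n \<Rightarrow> real \<Rightarrow>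
     ('k::finite \<Rightarrow> nat \<times> nat) \<Rightarrow> real ^ 'k \<Rightarrow> (real ^ 'j) set" where
  "response_utilities x B b \<Gamma> \<iota> s =
     {u \<in> utility_set B b. \<exists>\<epsilon> \<in> noise_set \<Gamma>. \<forall>\<kappa>.
        (s $ \<kappa> = 1 \<longrightarrow> u \<bullet> query_diff x \<iota> \<kappa> > - (\<epsilon> $ \<kappa>)) \<and>
        (s $ \<kappa> = 0 \<longrightarrow> \<bar>u \<bullet> query_diff x \<iota> \<kappa>\<bar> \<le> \<epsilon> $ \<kappa>) \<and>
        (s $ \<kappa> = -1 \<longrightarrow> u \<bullet> query_diff x \<iota> \<kappa> < \<epsilon> $ \<kappa>)}"

definition consistent_responses ::
    "(nat \<Rightarrow> real ^ 'j) \<Rightarrow> real ^ 'j ^ 'n \<Rightarrow> real ^ 'n \<Rightarrow> real \<Rightarrow>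
     ('k::finite \<Rightarrow> nat \<times> nat) \<Rightarrow> (real ^ 'k) set" where
  "consistent_responses x B b \<Gamma> \<iota> =
     {s \<in> sign_zero_vectors. response_utilities x B b \<Gamma> \<iota> s \<noteq> {}}"

definition qp_value_at ::
    "(nat \<Rightarrow> real ^ 'j) \<Rightarrow> (real ^ 'j) set \<Rightarrow> real ^ 'j ^ 'n \<Rightarrow> real ^ 'n \<Rightarrow> real \<Rightarrow>
     ('k::finite \<Rightarrow> nat \<times> nat) \<Rightarrow> ereal" where
  "qp_value_at x R B b \<Gamma> \<iota> =
     (INF s \<in> consistent_responses x B b \<Gamma> \<iota>. SUP y \<in> R.
        INF u \<in> response_utilities x B b \<Gamma> \<iota> s. ereal (u \<bullet> y))"

definition qp_value ::
    "'k::finite itself \<Rightarrow> nat \<Rightarrow> (nat \<Rightarrow> real ^ 'j) \<Rightarrow> (real ^ 'j) set \<Rightarrow> real ^ 'j ^ 'n \<Rightarrow>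
     real ^ 'n \<Rightarrow> real \<Rightarrow> ereal" where
  "qp_value _ I x R B b \<Gamma> =
     (SUP \<iota> \<in> (queries I :: ('k \<Rightarrow> nat \<times> nat) set). qp_value_at x R B b \<Gamma> \<iota>)"

definition qp_optimal_queries ::
    "nat \<Rightarrow> (nat \<Rightarrow> real ^ 'j) \<Rightarrow> (real ^ 'j) set \<Rightarrow> real ^ 'j ^ 'n \<Rightarrow> real ^ 'n \<Rightarrow> real \<Rightarrow>
     ('k::finite \<Rightarrow> nat \<times> nat) set" where
  "qp_optimal_queries I x R B b \<Gamma> =
     optimal_queries I (qp_value_at x R B b \<Gamma>) (qp_value TYPE('k) I x R B b \<Gamma>)"


section \<open>The finite program\<close>

text \<open>In both programs below, variables carrying a superscript \<open>s\<close> are functions of \<open>s :: real ^ 'k\<close>,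
  constrained only for \<open>s \<in> sign_vectors\<close>; \<open>X s\<close> is the recommendation \<open>x\<^sup>s\<close>.\<close>

definition fp_feasible ::
    "nat \<Rightarrow> (nat \<Rightarrow> real ^ 'j) \<Rightarrow> (real ^ 'j) set \<Rightarrow> real ^ 'j ^ 'n \<Rightarrow> real ^ 'n \<Rightarrow> real \<Rightarrow>
     real \<Rightarrow> ('k::finite \<Rightarrow> nat \<times> nat) \<Rightarrow> (real ^ 'k \<Rightarrow> real ^ 'j) \<Rightarrow>
     (real ^ 'k \<Rightarrow> real ^ 'k) \<Rightarrow> (real ^ 'k \<Rightarrow> real ^ 'n) \<Rightarrow> (real ^ 'k \<Rightarrow> real) \<Rightarrow> bool" where
  "fp_feasible I x R B b \<Gamma> \<tau> \<iota> X \<alpha> \<beta> \<mu> \<longleftrightarrow>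
     \<iota> \<in> queries I \<and>
     (\<forall>s \<in> sign_vectors.
        X s \<in> R \<and> \<alpha> s \<ge> 0 \<and> \<beta> s \<ge> 0 \<and> \<mu> s \<le> 0 \<and>
        \<tau> \<le> b \<bullet> \<beta> s + \<Gamma> * \<mu> s \<and>
        (\<Sum>\<kappa>\<in>UNIV. (s $ \<kappa> * \<alpha> s $ \<kappa>) *\<^sub>R query_diff x \<iota> \<kappa>) + transpose B *v \<beta> s = X s \<and>
        \<alpha> s + \<mu> s *\<^sub>R 1 \<le> 0)"

definition fp_value_at ::
    "nat \<Rightarrow> (nat \<Rightarrow> real ^ 'j) \<Rightarrow> (real ^ 'j) set \<Rightarrow> real ^ 'j ^ 'n \<Rightarrow> real ^ 'n \<Rightarrow> real \<Rightarrow>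
     ('k::finite \<Rightarrow> nat \<times> nat) \<Rightarrow> ereal" where
  "fp_value_at I x R B b \<Gamma> \<iota> =
     Sup {ereal \<tau> |\<tau>. \<exists>X \<alpha> \<beta> \<mu>. fp_feasible I x R B b \<Gamma> \<tau> \<iota> X \<alpha> \<beta> \<mu>}"

definition fp_value ::
    "'k::finite itself \<Rightarrow> nat \<Rightarrow> (nat \<Rightarrow> real ^ 'j) \<Rightarrow> (real ^ 'j) set \<Rightarrow> real ^ 'j ^ 'n \<Rightarrow>
     real ^ 'n \<Rightarrow> real \<Rightarrow> ereal" where
  "fp_value _ I x R B b \<Gamma> =
     Sup {ereal \<tau> |\<tau>. \<exists>(\<iota> :: 'k \<Rightarrow> nat \<times> nat) X \<alpha> \<beta> \<mu>. fp_feasible I x R B b \<Gamma> \<tau> \<iota> X \<alpha> \<beta> \<mu>}"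

definition fp_optimal_queries ::
    "nat \<Rightarrow> (nat \<Rightarrow> real ^ 'j) \<Rightarrow> (real ^ 'j) set \<Rightarrow> real ^ 'j ^ 'n \<Rightarrow> real ^ 'n \<Rightarrow> real \<Rightarrow>
     ('k::finite \<Rightarrow> nat \<times> nat) set" where
  "fp_optimal_queries I x R B b \<Gamma> =
     optimal_queries I (fp_value_at I x R B b \<Gamma>) (fp_value TYPE('k) I x R B b \<Gamma>)"


section \<open>The mixed-binary linear program\<close>

definition mblp_feasible ::
    "nat \<Rightarrow> (nat \<Rightarrow> real ^ 'j) \<Rightarrow> (real ^ 'j) set \<Rightarrow> real ^ 'j ^ 'n \<Rightarrow> real ^ 'n \<Rightarrow> real \<Rightarrow> real \<Rightarrow>
     real \<Rightarrow> ('k::finite \<Rightarrow> nat \<Rightarrow> real) \<Rightarrow> ('k \<Rightarrow> nat \<Rightarrow> real) \<Rightarrow>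
     (real ^ 'k \<Rightarrow> real ^ 'k) \<Rightarrow> (real ^ 'k \<Rightarrow> real ^ 'n) \<Rightarrow> (real ^ 'k \<Rightarrow> real) \<Rightarrow>
     (real ^ 'k \<Rightarrow> real ^ 'j) \<Rightarrow>
     (real ^ 'k \<Rightarrow> 'k \<Rightarrow> nat \<Rightarrow> real) \<Rightarrow> (real ^ 'k \<Rightarrow> 'k \<Rightarrow> nat \<Rightarrow> real) \<Rightarrow> bool" where
  "mblp_feasible I x R B b \<Gamma> M \<tau> v w \<alpha> \<beta> \<mu> X vb wb \<longleftrightarrow>
     (\<forall>\<kappa>. \<forall>i\<in>{1..I}. v \<kappa> i \<in> {0, 1} \<and> w \<kappa> i \<in> {0, 1}) \<and>
     (\<forall>s \<in> sign_vectors. \<alpha> s \<ge> 0 \<and> \<beta> s \<ge> 0 \<and> \<mu> s \<le> 0 \<and> X s \<in> R) \<and>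
     (\<forall>s \<in> sign_vectors. \<forall>\<kappa>. \<forall>i\<in>{1..I}. vb s \<kappa> i \<ge> 0 \<and> wb s \<kappa> i \<ge> 0) \<and>
     (\<forall>s \<in> sign_vectors.
        \<tau> \<le> b \<bullet> \<beta> s + \<Gamma> * \<mu> s \<and>
        (\<Sum>i=1..I. (\<Sum>\<kappa>\<in>UNIV. s $ \<kappa> * (vb s \<kappa> i - wb s \<kappa> i)) *\<^sub>R x i) + transpose B *v \<beta> s = X s \<and>
        \<alpha> s + \<mu> s *\<^sub>R 1 \<le> 0) \<and>
     (\<forall>\<kappa>. (\<Sum>i=1..I. v \<kappa> i) = 1 \<and> (\<Sum>i=1..I. w \<kappa> i) = 1 \<and>
        (\<forall>i\<in>{1..I}. 1 - w \<kappa> i \<ge> (\<Sum>i'=i..I. v \<kappa> i'))) \<and>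
     (\<forall>s \<in> sign_vectors. \<forall>\<kappa>. \<forall>i\<in>{1..I}.
        vb s \<kappa> i \<le> M * v \<kappa> i \<and> vb s \<kappa> i \<le> \<alpha> s $ \<kappa> \<and> vb s \<kappa> i \<ge> \<alpha> s $ \<kappa> - M * (1 - v \<kappa> i) \<and>
        wb s \<kappa> i \<le> M * w \<kappa> i \<and> wb s \<kappa> i \<le> \<alpha> s $ \<kappa> \<and> wb s \<kappa> i \<ge> \<alpha> s $ \<kappa> - M * (1 - w \<kappa> i))"

definition decode_index :: "nat \<Rightarrow> (nat \<Rightarrow> real) \<Rightarrow> nat" where
  "decode_index I v = (\<Sum>i=1..I. i * of_bool (v i = 1))"

definition decode_queries ::
    "nat \<Rightarrow> ('k \<Rightarrow> nat \<Rightarrow> real) \<Rightarrow> ('k \<Rightarrow> nat \<Rightarrow> real) \<Rightarrow> ('k \<Rightarrow> nat \<times> nat)" where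
  "decode_queries I v w = (\<lambda>\<kappa>. (decode_index I (v \<kappa>), decode_index I (w \<kappa>)))"

definition mblp_value_at ::
    "nat \<Rightarrow> (nat \<Rightarrow> real ^ 'j) \<Rightarrow> (real ^ 'j) set \<Rightarrow> real ^ 'j ^ 'n \<Rightarrow> real ^ 'n \<Rightarrow> real \<Rightarrow> real \<Rightarrow>
     ('k::finite \<Rightarrow> nat \<times> nat) \<Rightarrow> ereal" where
  "mblp_value_at I x R B b \<Gamma> M \<iota> =
     Sup {ereal \<tau> |\<tau>. \<exists>v w \<alpha> \<beta> \<mu> X vb wb.
       mblp_feasible I x R B b \<Gamma> M \<tau> v w \<alpha> \<beta> \<mu> X vb wb \<and> decode_queries I v w = \<iota>}"

definition mblp_value ::
    "'k::finite itself \<Rightarrow> nat \<Rightarrow> (nat \<Rightarrow> real ^ 'j) \<Rightarrow> (real ^ 'j) set \<Rightarrow> real ^ 'j ^ 'n \<Rightarrow>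
     real ^ 'n \<Rightarrow> real \<Rightarrow> real \<Rightarrow> ereal" where
  "mblp_value _ I x R B b \<Gamma> M =
     Sup {ereal \<tau> |\<tau>. \<exists>(v :: 'k \<Rightarrow> nat \<Rightarrow> real) w \<alpha> \<beta> \<mu> X vb wb.
       mblp_feasible I x R B b \<Gamma> M \<tau> v w \<alpha> \<beta> \<mu> X vb wb}"

definition mblp_optimal_queries ::
    "nat \<Rightarrow> (nat \<Rightarrow> real ^ 'j) \<Rightarrow> (real ^ 'j) set \<Rightarrow> real ^ 'j ^ 'n \<Rightarrow> real ^ 'n \<Rightarrow> real \<Rightarrow> real \<Rightarrow>
     ('k::finite \<Rightarrow> nat \<times> nat) set" where
  "mblp_optimal_queries I x R B b \<Gamma> M =
     optimal_queries I (mblp_value_at I x R B b \<Gamma> M) (mblp_value TYPE('k) I x R B b \<Gamma> M)"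

definition mblp_optimal ::
    "nat \<Rightarrow> (nat \<Rightarrow> real ^ 'j) \<Rightarrow> (real ^ 'j) set \<Rightarrow> real ^ 'j ^ 'n \<Rightarrow> real ^ 'n \<Rightarrow> real \<Rightarrow> real \<Rightarrow>
     real \<Rightarrow> ('k::finite \<Rightarrow> nat \<Rightarrow> real) \<Rightarrow> ('k \<Rightarrow> nat \<Rightarrow> real) \<Rightarrow>
     (real ^ 'k \<Rightarrow> real ^ 'k) \<Rightarrow> (real ^ 'k \<Rightarrow> real ^ 'n) \<Rightarrow> (real ^ 'k \<Rightarrow> real) \<Rightarrow>
     (real ^ 'k \<Rightarrow> real ^ 'j) \<Rightarrow>
     (real ^ 'k \<Rightarrow> 'k \<Rightarrow> nat \<Rightarrow> real) \<Rightarrow> (real ^ 'k \<Rightarrow> 'k \<Rightarrow> nat \<Rightarrow> real) \<Rightarrow> bool" where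
  "mblp_optimal I x R B b \<Gamma> M \<tau> v w \<alpha> \<beta> \<mu> X vb wb \<longleftrightarrow>
     mblp_feasible I x R B b \<Gamma> M \<tau> v w \<alpha> \<beta> \<mu> X vb wb \<and>
     (\<forall>\<tau>' (v' :: 'k \<Rightarrow> nat \<Rightarrow> real) w' \<alpha>' \<beta>' \<mu>' X' vb' wb'.
        mblp_feasible I x R B b \<Gamma> M \<tau>' v' w' \<alpha>' \<beta>' \<mu>' X' vb' wb' \<longrightarrow> \<tau>' \<le> \<tau>)"

end

theory Submission
  imports Defs
begin

text \<open>
  Fix the queries. By LP duality a value \<open>\<tau>\<close> is feasible in the finite program iff for every
  \<open>s \<in> {-1, 1}\<^sup>K\<close> some \<open>y \<in> R\<close> satisfies \<open>u \<bullet> y \<ge> \<tau>\<close> on the closed version of the utility set of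
  the response \<open>s\<close>. A discrete mixed-binary-linear representable set is a finite union of convex
  discrete sets, hence finite, so the optimal \<open>\<tau>\<close> for these queries is attained; the multipliers \<open>\<alpha>\<close>
  of one optimal solution per query vector bound the big-\<open>M\<close> constant.

  For the elicitation problem it remains to see that strict inequalities and zero responses do not
  matter. Each response set is contained in the closed set of some \<open>s \<in> {-1, 1}\<^sup>K\<close>. Conversely, each
  nonempty closed set lies in the closure of a nonempty response set: if some utility needs less
  noise than \<open>\<Gamma>\<close>, this is the response set of \<open>s\<close> itself. Otherwise the closed set is the face where
  the convex required noise attains its minimum \<open>\<Gamma>\<close>; no query changes sign on it, and setting
  \<open>s\<^sub>\<kappa> = 0\<close> for the queries answered against \<open>s\<close> or with equality gives the response.
\<close>

section \<open>Discrete representable sets are finite\<close>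

text \<open>A connected set with two points has no isolated point, whereas all points of a subset of
  a discrete set are isolated in it.\<close>

lemma discrete_convex_subset_singleton:
  fixes S :: "'a::real_normed_vector set"
  assumes "discrete S" "convex T" "T \<subseteq> S"
  shows "\<exists>a. T \<subseteq> {a}"
proof (cases "T = {}")
  case False
  then obtain a where a: "a \<in> T" by blast
  have "\<not> a islimpt T"
    using assms a by (meson discrete_def isolated_in_islimpt_iff islimpt_subset subsetD)
  then show ?thesis
    using connected_imp_perfect[OF convex_connected[OF assms(2)] a] by blast
qed auto

text \<open>Once the binary variables are fixed, what remains is the projection of a polyhedron; it
  is convex and hence has at most one point, and there are finitely many binary assignments.\<close>

lemma discrete_representable_finite:
  assumes "discrete R" "mixed_binary_linear_representable R"
  shows "finite R"
proof -
  obtain p q m A and C D :: "nat \<Rightarrow> nat \<Rightarrow> real" and c :: "nat \<Rightarrow> real" where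
    R: "R = {x. \<exists>(y :: nat \<Rightarrow> real) (z :: nat \<Rightarrow> real).
                  (\<forall>l<q. z l \<in> {0, 1}) \<and>
                  (\<forall>r<m. A r \<bullet> x + (\<Sum>l<p. C r l * y l) + (\<Sum>l<q. D r l * z l) \<ge> c r)}"
    using assms(2) unfolding mixed_binary_linear_representable_def by blast
  define Q where "Q a y z \<longleftrightarrow> (\<forall>r<m. A r \<bullet> a + (\<Sum>l<p. C r l * y l) +
      (\<Sum>l<q. D r l * z l) \<ge> c r)" for a and y z :: "nat \<Rightarrow> real"
  have R: "R = {a. \<exists>y z. (\<forall>l<q. z l \<in> {0, 1}) \<and> Q a y z}"
    unfolding R Q_def ..
  define P where "P Z = {a. \<exists>y. Q a y (\<lambda>l. of_bool (l \<in> Z))}" for Z :: "nat set"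
  have "convex (P Z)" for Z
  proof (rule convexI)
    fix x y u v assume xy: "x \<in> P Z" "y \<in> P Z" and uv: "0 \<le> u" "0 \<le> v" "u + v = (1::real)"
    define k where "k r = (\<Sum>l<q. D r l * of_bool (l \<in> Z))" for r
    obtain f g where
      f: "A r \<bullet> x + (\<Sum>l<p. C r l * f l) + k r \<ge> c r" and
      g: "A r \<bullet> y + (\<Sum>l<p. C r l * g l) + k r \<ge> c r" if "r < m" for r
      using xy unfolding P_def Q_def k_def by blast
    \<comment> \<open>The auxiliary real variables are averaged like the points; the fixed binary
      contribution \<open>k r\<close> survives because the weights sum to one.\<close>
    have "A r \<bullet> (u *\<^sub>R x + v *\<^sub>R y) + (\<Sum>l<p. C r l * (u * f l + v * g l)) + k r \<ge> c r"
      if "r < m" for r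
    proof -
      have "u * (A r \<bullet> x + (\<Sum>l<p. C r l * f l) + k r)
          + v * (A r \<bullet> y + (\<Sum>l<p. C r l * g l) + k r) \<ge> u * c r + v * c r"
        using f[OF that] g[OF that] uv by (intro add_mono mult_left_mono) auto
      moreover have "u * c r + v * c r = c r" "u * k r + v * k r = k r"
        using uv by (metis distrib_right mult_1)+
      moreover have "(\<Sum>l<p. C r l * (u * f l + v * g l))
          = u * (\<Sum>l<p. C r l * f l) + v * (\<Sum>l<p. C r l * g l)"
        by (simp add: sum_distrib_left sum.distrib algebra_simps)
      ultimately show ?thesis by (simp add: inner_add_right algebra_simps)
    qed
    then show "u *\<^sub>R x + v *\<^sub>R y \<in> P Z"
      unfolding P_def Q_def k_def
      by (intro CollectI exI[of _ "\<lambda>l. u * f l + v * g l"]) blast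
  qed
  moreover have "P Z \<subseteq> R" for Z
  proof
    fix a assume "a \<in> P Z"
    then obtain y where "Q a y (\<lambda>l. of_bool (l \<in> Z))"
      unfolding P_def by blast
    then show "a \<in> R"
      unfolding R by (intro CollectI exI[of _ y] exI[of _ "\<lambda>l. of_bool (l \<in> Z)"]) simp
  qed
  ultimately have "\<exists>a. P Z \<subseteq> {a}" for Z
    using discrete_convex_subset_singleton[OF assms(1)] by blast
  then have "finite (P Z)" for Z
    by (metis finite.emptyI finite_insert finite_subset)
  then have "finite (\<Union>Z\<in>Pow {..<q}. P Z)"
    by simp
  moreover have "R \<subseteq> (\<Union>Z\<in>Pow {..<q}. P Z)"
  proof
    fix a assume "a \<in> R"
    then obtain y z where z: "\<forall>l<q. z l \<in> {0, 1}" and yz: "Q a y z"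
      unfolding R by blast
    \<comment> \<open>Only positions below \<open>q\<close> are kept, so that \<open>?Z\<close>
      ranges over the finite power set of \<open>{..<q}\<close>.\<close>
    let ?Z = "{l. l < q \<and> z l = 1}"
    have "(\<Sum>l<q. D r l * of_bool (l \<in> ?Z)) = (\<Sum>l<q. D r l * z l)" for r
      using z by (intro sum.cong) auto
    then have "a \<in> P ?Z"
      using yz unfolding P_def Q_def by auto
    moreover have "?Z \<in> Pow {..<q}" by auto
    ultimately show "a \<in> (\<Union>Z\<in>Pow {..<q}. P Z)" by blast
  qed
  ultimately show ?thesis using finite_subset by blast
qed

section \<open>Linear programming duality\<close>

lemma inner_vector_matrix_mult:
  fixes B :: "real ^ 'j ^ 'n"
  shows "u \<bullet> (\<beta> v* B) = (B *v u) \<bullet> \<beta>"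
  by (metis dot_lmul_matrix inner_commute)

lemma inner_mono_vec:
  fixes a b \<beta> :: "real ^ 'n"
  assumes "a \<le> b" "\<beta> \<ge> 0"
  shows "a \<bullet> \<beta> \<le> b \<bullet> \<beta>"
  using assms by (auto simp: inner_vec_def less_eq_vec_def intro!: sum_mono mult_right_mono)

text \<open>Since \<alpha> is at most \<open>- \<mu>\<close> in each coordinate, a unit of violation
  costs at most \<open>- \<mu>\<close>, so the total loss is at most
  \<open>- \<Gamma> * \<mu>\<close>; the rows of \<open>B\<close> enter by pairing
  \<open>b \<le> B *v u\<close> with \<open>\<beta> \<ge> 0\<close>.\<close>

lemma weak_duality:
  fixes e :: "'k::finite \<Rightarrow> real ^ 'j"
  assumes u: "u \<in> utility_set B b" "(\<Sum>\<kappa>\<in>UNIV. max 0 (- (u \<bullet> e \<kappa>))) \<le> \<Gamma>"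
    and dual: "\<beta> \<ge> 0" "\<alpha> \<ge> 0" "\<mu> \<le> 0" "\<alpha> + \<mu> *\<^sub>R 1 \<le> 0"
  shows "b \<bullet> \<beta> + \<Gamma> * \<mu> \<le> u \<bullet> ((\<Sum>\<kappa>\<in>UNIV. \<alpha> $ \<kappa> *\<^sub>R e \<kappa>) + transpose B *v \<beta>)"
proof -
  have "\<mu> * max 0 (- (u \<bullet> e \<kappa>)) \<le> \<alpha> $ \<kappa> * (u \<bullet> e \<kappa>)" for \<kappa>
  proof -
    have a: "0 \<le> \<alpha> $ \<kappa>" "\<alpha> $ \<kappa> \<le> - \<mu>"
      using dual(2,4) by (auto simp: less_eq_vec_def dest: spec[of _ \<kappa>])
    show ?thesis
    proof (cases "u \<bullet> e \<kappa> \<ge> 0")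
      case False
      then have "(- \<mu>) * (u \<bullet> e \<kappa>) \<le> \<alpha> $ \<kappa> * (u \<bullet> e \<kappa>)"
        using a by (intro mult_right_mono_neg) auto
      with False show ?thesis by simp
    qed (use a in simp)
  qed
  then have "\<mu> * (\<Sum>\<kappa>\<in>UNIV. max 0 (- (u \<bullet> e \<kappa>))) \<le> (\<Sum>\<kappa>\<in>UNIV. \<alpha> $ \<kappa> * (u \<bullet> e \<kappa>))"
    by (simp add: sum_distrib_left sum_mono)
  moreover have "\<mu> * \<Gamma> \<le> \<mu> * (\<Sum>\<kappa>\<in>UNIV. max 0 (- (u \<bullet> e \<kappa>)))"
    using u(2) dual(3) by (intro mult_left_mono_neg)
  moreover have "b \<bullet> \<beta> \<le> (B *v u) \<bullet> \<beta>"
    using u(1) dual(1) by (intro inner_mono_vec) (auto simp: utility_set_def)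
  ultimately show ?thesis
    by (simp add: inner_add_right inner_sum_right inner_vector_matrix_mult mult.commute)
qed

text \<open>A Farkas argument: if \<open>(y, t)\<close> is outside the cone generated by the
  multipliers, a separating functional yields either a utility violating \<open>bound\<close> or a
  ray in the bounded set \<open>utility_set B b\<close>. If no utility meets the noise budget,
  \<open>bound\<close> is vacuous and the conclusion holds for every \<open>t\<close>.\<close>

lemma strong_duality:
  fixes e :: "'k::finite \<Rightarrow> real ^ 'j" and B :: "real ^ 'j ^ 'n"
  assumes ne: "utility_set B b \<noteq> {}" and bdd: "bounded (utility_set B b)"
    and bound: "\<And>u. u \<in> utility_set B b \<Longrightarrow>
      (\<Sum>\<kappa>\<in>UNIV. max 0 (- (u \<bullet> e \<kappa>))) \<le> \<Gamma> \<Longrightarrow> t \<le> u \<bullet> y"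
  obtains \<alpha> \<beta> \<mu> where "\<alpha> \<ge> 0" "\<beta> \<ge> 0" "\<mu> \<le> 0" "t \<le> b \<bullet> \<beta> + \<Gamma> * \<mu>"
    "(\<Sum>\<kappa>\<in>UNIV. \<alpha> $ \<kappa> *\<^sub>R e \<kappa>) + transpose B *v \<beta> = y" "\<alpha> + \<mu> *\<^sub>R 1 \<le> 0"
proof -
  define F where "F \<alpha> \<beta> = (\<Sum>\<kappa>\<in>UNIV. \<alpha> $ \<kappa> *\<^sub>R e \<kappa>) + transpose B *v \<beta>" for \<alpha> \<beta>
  have F_add: "F (\<alpha> + \<alpha>') (\<beta> + \<beta>') = F \<alpha> \<beta> + F \<alpha>' \<beta>'" for \<alpha> \<beta> \<alpha>' \<beta>'
    by (simp add: F_def scaleR_add_left sum.distrib matrix_vector_right_distrib)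
  have F_scale: "F (c *\<^sub>R \<alpha>) (c *\<^sub>R \<beta>) = c *\<^sub>R F \<alpha> \<beta>" for c \<alpha> \<beta>
    by (simp add: F_def scaleR_add_right scaleR_sum_right scaleR_matrix_vector_assoc
        matrix_vector_mult_scaleR)
  define Q where "Q \<alpha> \<beta> \<mu> \<longleftrightarrow> \<alpha> \<ge> 0 \<and> \<beta> \<ge> 0 \<and> \<mu> \<le> 0 \<and> \<alpha> + \<mu> *\<^sub>R 1 \<le> 0"
    for \<alpha> :: "real ^ 'k" and \<beta> :: "real ^ 'n" and \<mu>
  \<comment> \<open>The second coordinate may stay below the dual objective, so \<open>C\<close> is
    downward closed in it; the generator \<open>(0, -1)\<close> of \<open>G\<close> reflects
    this.\<close>
  define C where "C = {(F \<alpha> \<beta>, r) |\<alpha> \<beta> \<mu> r. Q \<alpha> \<beta> \<mu> \<and> r \<le> b \<bullet> \<beta> + \<Gamma> * \<mu>}"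
  have CI: "(F \<alpha> \<beta>, r) \<in> C" if "Q \<alpha> \<beta> \<mu>" "r \<le> b \<bullet> \<beta> + \<Gamma> * \<mu>" for \<alpha> \<beta> \<mu> r
    using that unfolding C_def by blast
  have zero: "Q 0 0 0" "F 0 0 = 0" by (simp_all add: Q_def F_def)
  have "convex_cone C"
    unfolding convex_cone_iff
  proof (intro conjI ballI allI impI)
    show "0 \<in> C" using CI[OF zero(1), of 0] zero(2) by (simp add: zero_prod_def)
  next
    fix p p' assume "p \<in> C" "p' \<in> C"
    then obtain \<alpha> \<beta> \<mu> r \<alpha>' \<beta>' \<mu>' r' where
      p: "p = (F \<alpha> \<beta>, r)" "Q \<alpha> \<beta> \<mu>" "r \<le> b \<bullet> \<beta> + \<Gamma> * \<mu>"
      "p' = (F \<alpha>' \<beta>', r')" "Q \<alpha>' \<beta>' \<mu>'" "r' \<le> b \<bullet> \<beta>' + \<Gamma> * \<mu>'"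
      unfolding C_def by blast
    have "\<alpha> + \<alpha>' + (\<mu> + \<mu>') *\<^sub>R 1 = (\<alpha> + \<mu> *\<^sub>R 1) + (\<alpha>' + \<mu>' *\<^sub>R 1)"
      by (simp add: algebra_simps)
    then have "Q (\<alpha> + \<alpha>') (\<beta> + \<beta>') (\<mu> + \<mu>')"
      using p unfolding Q_def by (metis add_nonneg_nonneg add_nonpos_nonpos)
    moreover have "r + r' \<le> b \<bullet> (\<beta> + \<beta>') + \<Gamma> * (\<mu> + \<mu>')"
      using p by (simp add: inner_add_right algebra_simps)
    moreover have "p + p' = (F (\<alpha> + \<alpha>') (\<beta> + \<beta>'), r + r')"
      using p by (simp add: F_add)
    ultimately show "p + p' \<in> C" using CI by simp
  next
    fix p and c :: real assume "p \<in> C" and c: "0 \<le> c"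
    then obtain \<alpha> \<beta> \<mu> r where
      p: "p = (F \<alpha> \<beta>, r)" "Q \<alpha> \<beta> \<mu>" "r \<le> b \<bullet> \<beta> + \<Gamma> * \<mu>"
      unfolding C_def by blast
    have "c *\<^sub>R \<alpha> + (c * \<mu>) *\<^sub>R 1 = c *\<^sub>R (\<alpha> + \<mu> *\<^sub>R 1)"
      by (simp add: algebra_simps)
    then have "Q (c *\<^sub>R \<alpha>) (c *\<^sub>R \<beta>) (c * \<mu>)"
      using p c by (auto simp: Q_def mult_nonneg_nonpos less_eq_vec_def)
    moreover have "c * r \<le> b \<bullet> (c *\<^sub>R \<beta>) + \<Gamma> * (c * \<mu>)"
      using mult_left_mono[OF p(3) c] by (simp add: algebra_simps)
    moreover have "c *\<^sub>R p = (F (c *\<^sub>R \<alpha>) (c *\<^sub>R \<beta>), c * r)"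
      using p by (simp add: F_scale)
    ultimately show "c *\<^sub>R p \<in> C" using CI by simp
  qed
  \<comment> \<open>The multipliers with \<open>0 \<le> \<alpha> \<le> - \<mu>\<close> form the cone spanned by the pairs of an indicator
    vector \<open>\<alpha>\<close> and \<open>\<mu> = -1\<close>, so finitely many generators suffice and the cone is closed.\<close>
  define G where "G = range (\<lambda>n. (transpose B *v axis n 1, b $ n))
    \<union> range (\<lambda>A. (\<Sum>\<kappa>\<in>A. e \<kappa>, - \<Gamma>)) \<union> {(0, -1)}"
  have "G \<subseteq> C"
  proof -
    have "(transpose B *v axis n 1, b $ n) \<in> C" for n
    proof -
      have "Q 0 (axis n 1) 0" by (simp add: Q_def axis_def less_eq_vec_def)
      moreover have "F 0 (axis n 1) = transpose B *v axis n 1" by (simp add: F_def)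
      moreover have "b $ n \<le> b \<bullet> axis n 1 + \<Gamma> * 0" by (simp add: inner_axis)
      ultimately show ?thesis using CI by metis
    qed
    moreover have "(\<Sum>\<kappa>\<in>A. e \<kappa>, - \<Gamma>) \<in> C" for A
    proof -
      have "Q (\<chi> \<kappa>. of_bool (\<kappa> \<in> A)) 0 (-1)" by (simp add: Q_def less_eq_vec_def)
      moreover have "F (\<chi> \<kappa>. of_bool (\<kappa> \<in> A)) 0 = (\<Sum>\<kappa>\<in>A. e \<kappa>)"
        unfolding F_def by (simp, rule sum.mono_neutral_cong_right) auto
      moreover have "- \<Gamma> \<le> b \<bullet> 0 + \<Gamma> * (-1)" by simp
      ultimately show ?thesis using CI by metis
    qed
    moreover have "(0, -1) \<in> C"
      using CI[OF zero(1), of "-1"] zero(2) by simp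
    ultimately show ?thesis unfolding G_def by blast
  qed
  then have hull: "convex_cone hull G \<subseteq> C"
    using \<open>convex_cone C\<close> by (rule hull_minimal)
  have "finite G" by (simp add: G_def)
  have "(y, t) \<in> convex_cone hull G"
  proof (rule ccontr)
    let ?H = "convex_cone hull G"
    assume "(y, t) \<notin> ?H"
    then obtain a c where "a \<bullet> (y, t) < c" and c: "\<And>p. p \<in> ?H \<Longrightarrow> c < a \<bullet> p"
      using separating_hyperplane_closed_point[OF convex_convex_cone_hull
          closed_convex_cone_hull[OF \<open>finite G\<close>]] by metis
    moreover have "c < 0" using c[OF convex_cone_hull_contains_0] by simp
    ultimately have yt: "a \<bullet> (y, t) < 0" by simp
    \<comment> \<open>If the functional were negative at a generator, the multiple of it on which
      the functional equals \<open>c\<close> would still lie in the cone, against strict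
      separation.\<close>
    have nonneg: "a \<bullet> p \<ge> 0" if "p \<in> G" for p
    proof (rule ccontr)
      assume neg: "\<not> a \<bullet> p \<ge> 0"
      have "p \<in> ?H" using that by (rule hull_inc)
      then have "(c / (a \<bullet> p)) *\<^sub>R p \<in> ?H"
        using neg \<open>c < 0\<close> by (intro convex_cone_hull_mul) (auto simp: divide_nonpos_nonpos)
      from c[OF this] neg show False by simp
    qed
    obtain u \<theta> where a: "a = (u, \<theta>)" by (cases a)
    have row: "(B *v u) $ n + \<theta> * b $ n \<ge> 0" for n
      using nonneg[of "(transpose B *v axis n 1, b $ n)"]
      by (auto simp: a G_def inner_vector_matrix_mult inner_axis)
    have subsetA: "u \<bullet> (\<Sum>\<kappa>\<in>A. e \<kappa>) - \<theta> * \<Gamma> \<ge> 0" for A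
      using nonneg[of "(\<Sum>\<kappa>\<in>A. e \<kappa>, - \<Gamma>)"] by (auto simp: a G_def)
    have \<theta>: "\<theta> \<le> 0" using nonneg[of "(0, -1)"] by (auto simp: a G_def)
    show False
    proof (cases "\<theta> = 0")
      \<comment> \<open>Now \<open>B *v u \<ge> 0\<close>, so \<open>u\<close> is a recession
        direction of \<open>utility_set B b\<close>; it is nonzero because
        \<open>a \<bullet> (y, t) < 0\<close>.\<close>
      case True
      obtain u0 where u0: "u0 \<in> utility_set B b" using ne by blast
      have "u \<noteq> 0" using yt a True by auto
      obtain L where L: "\<And>v. v \<in> utility_set B b \<Longrightarrow> norm v \<le> L"
        using bdd by (auto simp: bounded_iff)
      have "u0 + r *\<^sub>R u \<in> utility_set B b" if "r \<ge> 0" for r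
        using u0 row that True
        by (auto simp: utility_set_def matrix_vector_right_distrib matrix_vector_mult_scaleR
            less_eq_vec_def add_increasing2)
      then have *: "norm (u0 + r *\<^sub>R u) \<le> L" if "r \<ge> 0" for r using L that by blast
      define r where "r = (L + norm u0 + 1) / norm u"
      have "L \<ge> 0" using *[of 0] by (smt (verit) norm_ge_zero)
      then have "r \<ge> 0" by (simp add: r_def)
      have "norm (r *\<^sub>R u) = L + norm u0 + 1"
        using \<open>L \<ge> 0\<close> \<open>u \<noteq> 0\<close> by (simp add: r_def)
      with *[OF \<open>r \<ge> 0\<close>] show False
        using norm_triangle_ineq4[of "u0 + r *\<^sub>R u" u0] by simp
    next
      case False
      with \<theta> have \<theta>: "\<theta> < 0" by simp
      \<comment> \<open>Dividing by \<open>- \<theta> > 0\<close> turns the separating functional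
        into a utility \<open>w\<close> with \<open>w \<bullet> y < t\<close>.\<close>
      define w where "w = (- inverse \<theta>) *\<^sub>R u"
      have u: "u = (- \<theta>) *\<^sub>R w" using \<theta> by (simp add: w_def)
      have "b $ n \<le> (B *v w) $ n" for n
      proof -
        have "(- \<theta>) * b $ n \<le> (- \<theta>) * (B *v w) $ n"
          using row[of n] unfolding u
          by (simp only: matrix_vector_mult_scaleR vector_scaleR_component) simp
        then show ?thesis using \<theta> by (metis mult_le_cancel_left_pos neg_0_less_iff_less)
      qed
      then have "w \<in> utility_set B b" by (simp add: utility_set_def less_eq_vec_def)
      moreover have "(\<Sum>\<kappa>\<in>UNIV. max 0 (- (w \<bullet> e \<kappa>))) \<le> \<Gamma>"
      proof -
        \<comment> \<open>The generator indexed by exactly the violated inequalities gives the bound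
          on the sum of positive parts.\<close>
        let ?A = "{\<kappa>. w \<bullet> e \<kappa> < 0}"
        have "(- \<theta>) * (- (w \<bullet> (\<Sum>\<kappa>\<in>?A. e \<kappa>))) \<le> (- \<theta>) * \<Gamma>"
          using subsetA[of ?A] unfolding u by simp
        then have "- (w \<bullet> (\<Sum>\<kappa>\<in>?A. e \<kappa>)) \<le> \<Gamma>"
          using \<theta> by (metis mult_le_cancel_left_pos neg_0_less_iff_less)
        moreover have "(\<Sum>\<kappa>\<in>UNIV. max 0 (- (w \<bullet> e \<kappa>))) = (\<Sum>\<kappa>\<in>?A. - (w \<bullet> e \<kappa>))"
          by (rule sum.mono_neutral_cong_right) auto
        ultimately show ?thesis by (simp add: inner_sum_right sum_negf)
      qed
      ultimately have "t \<le> w \<bullet> y" by (rule bound)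
      moreover have "(- \<theta>) * (w \<bullet> y) < (- \<theta>) * t" using yt unfolding a u by simp
      ultimately show False using \<theta>
        by (metis mult_less_cancel_left_pos neg_0_less_iff_less not_le)
    qed
  qed
  with hull have "(y, t) \<in> C" by blast
  then obtain \<alpha> \<beta> \<mu> where "F \<alpha> \<beta> = y" "Q \<alpha> \<beta> \<mu>" "t \<le> b \<bullet> \<beta> + \<Gamma> * \<mu>"
    unfolding C_def by blast
  then show ?thesis using that[of \<alpha> \<beta> \<mu>] unfolding Q_def F_def by blast
qed

section \<open>The finite program\<close>

text \<open>\<open>required_noise\<close> is the least total noise \<open>\<Sum>\<kappa>. \<epsilon>\<^sub>\<kappa>\<close> for which \<open>u\<close> satisfies the weak
  inequalities of the response \<open>s\<close>; it eliminates \<open>\<epsilon>\<close> from the closed version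
  \<open>tolerant_utilities\<close> of \<open>response_utilities\<close>.\<close>

definition required_noise ::
    "(nat \<Rightarrow> real ^ 'j) \<Rightarrow> ('k::finite \<Rightarrow> nat \<times> nat) \<Rightarrow> real ^ 'k \<Rightarrow> real ^ 'j \<Rightarrow> real" where
  "required_noise x \<iota> s u = (\<Sum>\<kappa>\<in>UNIV. max 0 (- (u \<bullet> (s $ \<kappa> *\<^sub>R query_diff x \<iota> \<kappa>))))"

definition tolerant_utilities ::
    "(nat \<Rightarrow> real ^ 'j) \<Rightarrow> real ^ 'j ^ 'n \<Rightarrow> real ^ 'n \<Rightarrow> real \<Rightarrow>
     ('k::finite \<Rightarrow> nat \<times> nat) \<Rightarrow> real ^ 'k \<Rightarrow> (real ^ 'j) set" where
  "tolerant_utilities x B b \<Gamma> \<iota> s = {u \<in> utility_set B b. required_noise x \<iota> s u \<le> \<Gamma>}"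

text \<open>Feasibility of \<tau> for fixed queries with the dual variables eliminated. For a sign
  vector without tolerant utilities the condition only asks that \<open>R\<close> be
  nonempty.\<close>

definition guaranteed ::
    "(nat \<Rightarrow> real ^ 'j) \<Rightarrow> (real ^ 'j) set \<Rightarrow> real ^ 'j ^ 'n \<Rightarrow> real ^ 'n \<Rightarrow> real \<Rightarrow>
     ('k::finite \<Rightarrow> nat \<times> nat) \<Rightarrow> real \<Rightarrow> bool" where
  "guaranteed x R B b \<Gamma> \<iota> \<tau> \<longleftrightarrow>
     (\<forall>s \<in> sign_vectors. \<exists>y \<in> R. \<forall>u \<in> tolerant_utilities x B b \<Gamma> \<iota> s. \<tau> \<le> u \<bullet> y)"

text \<open>Duality is applied to each sign vector separately, with the signed differences
  \<open>s $ \<kappa> *\<^sub>R query_diff x \<iota> \<kappa>\<close> in the role of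
  \<open>e\<close>; different sign vectors are linked only through \<tau> and \<iota>.\<close>

lemma ex_fp_feasible_iff:
  fixes \<iota> :: "'k::finite \<Rightarrow> nat \<times> nat"
  assumes ne: "utility_set B b \<noteq> {}" and bdd: "bounded (utility_set B b)"
  shows "(\<exists>X \<alpha> \<beta> \<mu>. fp_feasible I x R B b \<Gamma> \<tau> \<iota> X \<alpha> \<beta> \<mu>) \<longleftrightarrow>
    \<iota> \<in> queries I \<and> guaranteed x R B b \<Gamma> \<iota> \<tau>"
proof (intro iffI; (elim exE conjE)?)
  fix X \<alpha> \<beta> \<mu> assume fp: "fp_feasible I x R B b \<Gamma> \<tau> \<iota> X \<alpha> \<beta> \<mu>"
  have "\<tau> \<le> u \<bullet> X s" if s: "s \<in> sign_vectors" and u: "u \<in> tolerant_utilities x B b \<Gamma> \<iota> s" for s u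
  proof -
    have "X s = (\<Sum>\<kappa>\<in>UNIV. \<alpha> s $ \<kappa> *\<^sub>R (s $ \<kappa> *\<^sub>R query_diff x \<iota> \<kappa>)) + transpose B *v \<beta> s"
      using fp s by (simp add: fp_feasible_def mult.commute)
    moreover have dual: "\<beta> s \<ge> 0" "\<alpha> s \<ge> 0" "\<mu> s \<le> 0" "\<alpha> s + \<mu> s *\<^sub>R 1 \<le> 0"
      and "\<tau> \<le> b \<bullet> \<beta> s + \<Gamma> * \<mu> s"
      using fp s by (auto simp: fp_feasible_def)
    ultimately show ?thesis
      using weak_duality[of u B b "\<lambda>\<kappa>. s $ \<kappa> *\<^sub>R query_diff x \<iota> \<kappa>" \<Gamma>, OF _ _ dual] u
      by (simp only: tolerant_utilities_def required_noise_def mem_Collect_eq) force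
  qed
  then show "\<iota> \<in> queries I \<and> guaranteed x R B b \<Gamma> \<iota> \<tau>"
    using fp by (auto simp: fp_feasible_def guaranteed_def)
next
  assume \<iota>: "\<iota> \<in> queries I" and g: "guaranteed x R B b \<Gamma> \<iota> \<tau>"
  \<comment> \<open>The conditions for one sign vector are bundled so that a single choice yields a
    recommendation and multipliers that belong together.\<close>
  define P where "P s y \<alpha> \<beta> \<mu> \<longleftrightarrow> y \<in> R \<and> \<alpha> \<ge> 0 \<and> \<beta> \<ge> 0 \<and> \<mu> \<le> 0 \<and> \<tau> \<le> b \<bullet> \<beta> + \<Gamma> * \<mu> \<and>
      (\<Sum>\<kappa>\<in>UNIV. (s $ \<kappa> * \<alpha> $ \<kappa>) *\<^sub>R query_diff x \<iota> \<kappa>) + transpose B *v \<beta> = y \<and>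
      \<alpha> + \<mu> *\<^sub>R 1 \<le> 0" for s \<alpha> :: "real ^ 'k" and y \<beta> \<mu>
  have "\<exists>y \<alpha> \<beta> \<mu>. P s y \<alpha> \<beta> \<mu>" if s: "s \<in> sign_vectors" for s
  proof -
    obtain y where y: "y \<in> R" "\<forall>u\<in>tolerant_utilities x B b \<Gamma> \<iota> s. \<tau> \<le> u \<bullet> y"
      using g s unfolding guaranteed_def by blast
    have bound: "\<tau> \<le> u \<bullet> y" if "u \<in> utility_set B b"
      "(\<Sum>\<kappa>\<in>UNIV. max 0 (- (u \<bullet> (s $ \<kappa> *\<^sub>R query_diff x \<iota> \<kappa>)))) \<le> \<Gamma>" for u
      using y(2) that by (simp add: tolerant_utilities_def required_noise_def)
    obtain \<alpha> \<beta> \<mu> where "\<alpha> \<ge> 0" "\<beta> \<ge> 0" "\<mu> \<le> 0" "\<tau> \<le> b \<bullet> \<beta> + \<Gamma> * \<mu>"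
      "(\<Sum>\<kappa>\<in>UNIV. \<alpha> $ \<kappa> *\<^sub>R (s $ \<kappa> *\<^sub>R query_diff x \<iota> \<kappa>)) + transpose B *v \<beta> = y"
      "\<alpha> + \<mu> *\<^sub>R 1 \<le> 0"
      by (rule strong_duality[OF ne bdd bound])
    then have "P s y \<alpha> \<beta> \<mu>"
      unfolding P_def using y(1) by (simp add: mult.commute)
    then show ?thesis by blast
  qed
  then obtain X \<alpha> \<beta> \<mu> where "P s (X s) (\<alpha> s) (\<beta> s) (\<mu> s)" if "s \<in> sign_vectors" for s
    by metis
  with \<iota> have "fp_feasible I x R B b \<Gamma> \<tau> \<iota> X \<alpha> \<beta> \<mu>"
    unfolding fp_feasible_def P_def by blast
  then show "\<exists>X \<alpha> \<beta> \<mu>. fp_feasible I x R B b \<Gamma> \<tau> \<iota> X \<alpha> \<beta> \<mu>"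
    by blast
qed

section \<open>Attainment of the optimal value and a uniform bound on the multipliers\<close>

lemma closed_guaranteed:
  assumes "finite R"
  shows "closed {\<tau>. guaranteed x R B b \<Gamma> \<iota> \<tau>}"
proof -
  \<comment> \<open>The union over \<open>y\<close> is finite, so it stays closed.\<close>
  have "{\<tau>. guaranteed x R B b \<Gamma> \<iota> \<tau>} =
      (\<Inter>s\<in>sign_vectors. \<Union>y\<in>R. \<Inter>u\<in>tolerant_utilities x B b \<Gamma> \<iota> s. {..u \<bullet> y})"
    by (auto simp: guaranteed_def)
  then show ?thesis
    using assms by (auto intro!: closed_INT closed_UN)
qed

lemma guaranteed_max:
  fixes \<iota> :: "'k::finite \<Rightarrow> nat \<times> nat"
  assumes ne: "utility_set B b \<noteq> {}" and bdd: "bounded (utility_set B b)"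
    and \<Gamma>: "\<Gamma> \<ge> 0" and R: "finite R" "R \<noteq> {}"
  obtains m where "guaranteed x R B b \<Gamma> \<iota> m"
    "\<And>\<tau>. guaranteed x R B b \<Gamma> \<iota> \<tau> \<Longrightarrow> \<tau> \<le> m"
proof -
  let ?T = "{\<tau>. guaranteed x R B b \<Gamma> \<iota> \<tau>}"
  obtain L where L: "\<And>u. u \<in> utility_set B b \<Longrightarrow> norm u \<le> L"
    using bdd by (auto simp: bounded_iff)
  obtain y where y: "y \<in> R" using R by blast
  \<comment> \<open>By Cauchy-Schwarz a fixed recommendation \<open>y\<close> secures the same
    finite value for every sign vector, so guaranteed values exist.\<close>
  have "- (L * norm y) \<le> u \<bullet> y" if "u \<in> utility_set B b" for u
  proof -
    have "\<bar>u \<bullet> y\<bar> \<le> norm u * norm y" by (rule Cauchy_Schwarz_ineq2)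
    also have "\<dots> \<le> L * norm y" using L[OF that] by (intro mult_right_mono) auto
    finally show ?thesis by linarith
  qed
  then have "- (L * norm y) \<in> ?T"
    using y by (auto simp: guaranteed_def tolerant_utilities_def)
  then have T_ne: "?T \<noteq> {}" by blast
  obtain u where u: "u \<in> utility_set B b" using ne by blast
  \<comment> \<open>The truthful answers of \<open>u\<close> require no noise, so \<open>u\<close>
    is tolerant for this \<open>s\<close> and caps every guaranteed value.\<close>
  define s :: "real ^ 'k" where "s = (\<chi> \<kappa>. if u \<bullet> query_diff x \<iota> \<kappa> \<ge> 0 then 1 else -1)"
  have "s \<in> sign_vectors" by (simp add: s_def sign_vectors_def)
  have "required_noise x \<iota> s u = 0"
    unfolding required_noise_def by (intro sum.neutral) (simp add: s_def)
  then have "u \<in> tolerant_utilities x B b \<Gamma> \<iota> s"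
    using u \<Gamma> by (simp add: tolerant_utilities_def)
  with \<open>s \<in> sign_vectors\<close> have "\<exists>y\<in>R. \<tau> \<le> u \<bullet> y" if "guaranteed x R B b \<Gamma> \<iota> \<tau>" for \<tau>
    using that unfolding guaranteed_def by blast
  then have "\<tau> \<le> Max ((\<lambda>y. u \<bullet> y) ` R)" if "guaranteed x R B b \<Gamma> \<iota> \<tau>" for \<tau>
    using that R by (auto simp: Max_ge_iff)
  then have T_bdd: "bdd_above ?T" by (auto intro!: bdd_aboveI)
  show ?thesis
    using closed_contains_Sup[OF T_ne T_bdd closed_guaranteed[OF R(1)]] cSup_upper[OF _ T_bdd] that
    by blast
qed

lemma finite_queries: "finite (queries I :: ('k::finite \<Rightarrow> nat \<times> nat) set)"
proof (rule finite_subset)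
  show "queries I \<subseteq> {f :: 'k \<Rightarrow> nat \<times> nat. range f \<subseteq> {0..I} \<times> {0..I}}"
  proof (intro subsetI CollectI)
    fix \<iota> :: "'k \<Rightarrow> nat \<times> nat" and p
    assume "\<iota> \<in> queries I" "p \<in> range \<iota>"
    then have "p \<in> comparisons I" by (auto simp: queries_def)
    then show "p \<in> {0..I} \<times> {0..I}" by (auto simp: comparisons_def)
  qed
  have "finite {f :: 'k \<Rightarrow> nat \<times> nat. \<forall>\<kappa>. (\<kappa> \<in> UNIV \<longrightarrow> f \<kappa> \<in> {0..I} \<times> {0..I}) \<and>
      (\<kappa> \<notin> UNIV \<longrightarrow> f \<kappa> = undefined)}"
    by (rule finite_set_of_finite_funs) auto
  then show "finite {f :: 'k \<Rightarrow> nat \<times> nat. range f \<subseteq> {0..I} \<times> {0..I}}"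
    by (rule rev_finite_subset) auto
qed

lemma finite_sign_vectors: "finite (sign_vectors :: (real ^ 'k) set)"
proof (rule finite_subset)
  have "finite {f :: 'k \<Rightarrow> real. \<forall>\<kappa>. (\<kappa> \<in> UNIV \<longrightarrow> f \<kappa> \<in> {-1, 1}) \<and>
      (\<kappa> \<notin> UNIV \<longrightarrow> f \<kappa> = undefined)}"
    by (rule finite_set_of_finite_funs) auto
  then show "finite (vec_lambda ` {f :: 'k \<Rightarrow> real. \<forall>\<kappa>. f \<kappa> \<in> {-1, 1}})"
    by simp
  show "sign_vectors \<subseteq> vec_lambda ` {f :: 'k \<Rightarrow> real. \<forall>\<kappa>. f \<kappa> \<in> {-1, 1}}"
  proof
    fix s :: "real ^ 'k" assume "s \<in> sign_vectors"
    then show "s \<in> vec_lambda ` {f. \<forall>\<kappa>. f \<kappa> \<in> {-1, 1}}"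
      by (intro image_eqI[of _ _ "($) s"]) (auto simp: sign_vectors_def)
  qed
qed

text \<open>In the finite program \<tau> is only bounded from above, so a solution with the largest
  value for given queries serves all smaller values too; thus finitely many multipliers have to be
  bounded.\<close>

lemma fp_multipliers_bounded:
  fixes x :: "nat \<Rightarrow> real ^ 'j"
  assumes ne: "utility_set B b \<noteq> {}" and bdd: "bounded (utility_set B b)"
    and \<Gamma>: "\<Gamma> \<ge> 0" and R: "finite R"
  obtains M0 where
    "\<And>\<tau> (\<iota> :: 'k::finite \<Rightarrow> nat \<times> nat). \<exists>X \<alpha> \<beta> \<mu>. fp_feasible I x R B b \<Gamma> \<tau> \<iota> X \<alpha> \<beta> \<mu> \<Longrightarrow>
      \<exists>X \<alpha> \<beta> \<mu>. fp_feasible I x R B b \<Gamma> \<tau> \<iota> X \<alpha> \<beta> \<mu> \<and> (\<forall>s\<in>sign_vectors. \<forall>\<kappa>. \<alpha> s $ \<kappa> \<le> M0)"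
proof -
  let ?F = "fp_feasible I x R B b \<Gamma>"
  have "\<exists>M0. \<forall>\<tau>. guaranteed x R B b \<Gamma> \<iota> \<tau> \<longrightarrow>
      (\<exists>X \<alpha> \<beta> \<mu>. ?F \<tau> \<iota> X \<alpha> \<beta> \<mu> \<and> (\<forall>s\<in>sign_vectors. \<forall>\<kappa>. \<alpha> s $ \<kappa> \<le> M0))"
    if \<iota>: "\<iota> \<in> queries I" for \<iota> :: "'k \<Rightarrow> nat \<times> nat"
  proof (cases "R = {}")
    case True
    have "(1 :: real ^ 'k) \<in> sign_vectors" by (simp add: sign_vectors_def)
    then have "\<not> guaranteed x R B b \<Gamma> \<iota> \<tau>" for \<tau> using True by (auto simp: guaranteed_def)
    then show ?thesis by blast
  next
    case False
    obtain m where m: "guaranteed x R B b \<Gamma> \<iota> m"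
      "\<And>\<tau>. guaranteed x R B b \<Gamma> \<iota> \<tau> \<Longrightarrow> \<tau> \<le> m"
      using guaranteed_max[OF ne bdd \<Gamma> R False] by metis
    obtain X \<alpha> \<beta> \<mu> where fp: "?F m \<iota> X \<alpha> \<beta> \<mu>"
      using m(1) \<iota> ex_fp_feasible_iff[OF ne bdd] by metis
    have "finite ((\<lambda>(s, \<kappa>). \<alpha> s $ \<kappa>) ` (sign_vectors \<times> UNIV))"
      by (simp add: finite_sign_vectors)
    then obtain M0 where "\<And>a. a \<in> (\<lambda>(s, \<kappa>). \<alpha> s $ \<kappa>) ` (sign_vectors \<times> UNIV) \<Longrightarrow> a \<le> M0"
      using bdd_above_finite by (meson bdd_above_def)
    then have "\<forall>s\<in>sign_vectors. \<forall>\<kappa>. \<alpha> s $ \<kappa> \<le> M0" by force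
    moreover have "?F \<tau> \<iota> X \<alpha> \<beta> \<mu>" if "\<tau> \<le> m" for \<tau>
      using fp that unfolding fp_feasible_def by (meson order_trans)
    ultimately show ?thesis using m(2) by blast
  qed
  then obtain M where M: "\<And>(\<iota> :: 'k \<Rightarrow> nat \<times> nat) \<tau>. \<iota> \<in> queries I \<Longrightarrow> guaranteed x R B b \<Gamma> \<iota> \<tau> \<Longrightarrow>
      \<exists>X \<alpha> \<beta> \<mu>. ?F \<tau> \<iota> X \<alpha> \<beta> \<mu> \<and> (\<forall>s\<in>sign_vectors. \<forall>\<kappa>. \<alpha> s $ \<kappa> \<le> M \<iota>)"
    by metis
  have "bdd_above (M ` queries I)"
    by (intro bdd_above_finite finite_imageI finite_queries)
  then obtain M0 where M0: "\<forall>\<iota>\<in>queries I. M \<iota> \<le> M0"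
    by (auto simp: bdd_above_def)
  show ?thesis
  proof (rule that)
    fix \<tau> and \<iota> :: "'k \<Rightarrow> nat \<times> nat"
    assume "\<exists>X \<alpha> \<beta> \<mu>. ?F \<tau> \<iota> X \<alpha> \<beta> \<mu>"
    then have "\<iota> \<in> queries I" "guaranteed x R B b \<Gamma> \<iota> \<tau>"
      using ex_fp_feasible_iff[OF ne bdd] by blast+
    then obtain X \<alpha> \<beta> \<mu> where "?F \<tau> \<iota> X \<alpha> \<beta> \<mu>" "\<forall>s\<in>sign_vectors. \<forall>\<kappa>. \<alpha> s $ \<kappa> \<le> M \<iota>"
      using M by metis
    moreover have "M \<iota> \<le> M0"
      using M0 \<open>\<iota> \<in> queries I\<close> by blast
    ultimately show "\<exists>X \<alpha> \<beta> \<mu>. ?F \<tau> \<iota> X \<alpha> \<beta> \<mu> \<and> (\<forall>s\<in>sign_vectors. \<forall>\<kappa>. \<alpha> s $ \<kappa> \<le> M0)"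
      using order_trans by blast
  qed
qed

section \<open>The mixed-binary linear program\<close>

text \<open>The sum of a binary vector counts its ones, so the support is a single index, and
  \<open>decode_index\<close> adds up just that index.\<close>

lemma binary_sum_one_unit:
  fixes v :: "nat \<Rightarrow> real"
  assumes bin: "\<And>i. i \<in> {1..I} \<Longrightarrow> v i \<in> {0, 1}" and sum: "(\<Sum>i=1..I. v i) = 1"
  shows "decode_index I v \<in> {1..I}"
    and "i \<in> {1..I} \<Longrightarrow> v i = of_bool (i = decode_index I v)"
proof -
  have "(\<Sum>i=1..I. v i) = (\<Sum>i=1..I. of_bool (v i = 1))"
    using bin by (intro sum.cong) auto
  then have "card ({1..I} \<inter> {i. v i = 1}) = 1" using sum by simp
  then obtain j where j: "{1..I} \<inter> {i. v i = 1} = {j}" by (auto simp: card_1_singleton_iff)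
  then have jI: "j \<in> {1..I}" by blast
  have "v i = 1 \<longleftrightarrow> i = j" if "i \<in> {1..I}" for i using j that by blast
  then have unit: "v i = of_bool (i = j)" if "i \<in> {1..I}" for i using bin[OF that] that by auto
  have "decode_index I v = (\<Sum>i=1..I. if i = j then j else 0)"
    unfolding decode_index_def by (intro sum.cong) (auto simp: unit)
  also have "\<dots> = j" using jI by (subst sum.delta) auto
  finally have "decode_index I v = j" .
  then show "decode_index I v \<in> {1..I}"
    and "i \<in> {1..I} \<Longrightarrow> v i = of_bool (i = decode_index I v)"
    using jI unit by auto
qed

text \<open>The hypotheses describe the linearised products: \<open>vb\<close> and \<open>wb\<close>
  put the weight \<open>a \<kappa>\<close> on the two compared items and zero elsewhere. After
  exchanging the sums, each query contributes its own difference.\<close>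

lemma sum_unit_eq_query_diff:
  fixes \<iota> :: "'k::finite \<Rightarrow> nat \<times> nat"
  assumes \<iota>: "\<iota> \<in> queries I"
    and vb: "\<And>\<kappa> i. i \<in> {1..I} \<Longrightarrow> vb \<kappa> i = a \<kappa> * of_bool (i = fst (\<iota> \<kappa>))"
    and wb: "\<And>\<kappa> i. i \<in> {1..I} \<Longrightarrow> wb \<kappa> i = a \<kappa> * of_bool (i = snd (\<iota> \<kappa>))"
  shows "(\<Sum>i=1..I. (\<Sum>\<kappa>\<in>UNIV. c \<kappa> * (vb \<kappa> i - wb \<kappa> i)) *\<^sub>R x i) =
    (\<Sum>\<kappa>\<in>UNIV. (c \<kappa> * a \<kappa>) *\<^sub>R query_diff x \<iota> \<kappa>)"
proof -
  have pick: "(\<Sum>i=1..I. of_bool (i = j) *\<^sub>R x i) = x j" if "j \<in> {1..I}" for j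
  proof -
    have "(\<Sum>i=1..I. of_bool (i = j) *\<^sub>R x i) = (\<Sum>i=1..I. if i = j then x i else 0)"
      by (rule sum.cong) auto
    also have "\<dots> = x j" using that by simp
    finally show ?thesis .
  qed
  have "(\<Sum>i=1..I. (\<Sum>\<kappa>\<in>UNIV. c \<kappa> * (vb \<kappa> i - wb \<kappa> i)) *\<^sub>R x i) =
      (\<Sum>i=1..I. \<Sum>\<kappa>\<in>UNIV. (c \<kappa> * (vb \<kappa> i - wb \<kappa> i)) *\<^sub>R x i)"
    by (simp add: scaleR_sum_left)
  also have "\<dots> = (\<Sum>\<kappa>\<in>UNIV. \<Sum>i=1..I. (c \<kappa> * (vb \<kappa> i - wb \<kappa> i)) *\<^sub>R x i)"
    by (rule sum.swap)
  also have "\<dots> = (\<Sum>\<kappa>\<in>UNIV. (c \<kappa> * a \<kappa>) *\<^sub>R query_diff x \<iota> \<kappa>)"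
  proof (rule sum.cong[OF refl])
    fix \<kappa>
    have "fst (\<iota> \<kappa>) \<in> {1..I}" "snd (\<iota> \<kappa>) \<in> {1..I}"
      using \<iota> by (auto simp: queries_def comparisons_def split_beta dest!: spec[of _ \<kappa>])
    then have *: "query_diff x \<iota> \<kappa> = (\<Sum>i=1..I. of_bool (i = fst (\<iota> \<kappa>)) *\<^sub>R x i)
        - (\<Sum>i=1..I. of_bool (i = snd (\<iota> \<kappa>)) *\<^sub>R x i)"
      by (simp only: query_diff_def pick)
    show "(\<Sum>i=1..I. (c \<kappa> * (vb \<kappa> i - wb \<kappa> i)) *\<^sub>R x i) = (c \<kappa> * a \<kappa>) *\<^sub>R query_diff x \<iota> \<kappa>"
      unfolding * sum_subtractf[symmetric] scaleR_sum_right
      by (intro sum.cong refl) (simp add: vb wb algebra_simps)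
  qed
  finally show ?thesis .
qed

text \<open>This direction works for every \<open>M\<close>: the linearisation constraints leave
  \<open>vb\<close> and \<open>wb\<close> no values other than the products of \<alpha> with the
  binary variables.\<close>

lemma mblp_feasible_imp_fp_feasible:
  fixes v :: "'k::finite \<Rightarrow> nat \<Rightarrow> real"
  assumes "mblp_feasible I x R B b \<Gamma> M \<tau> v w \<alpha> \<beta> \<mu> X vb wb"
  shows "fp_feasible I x R B b \<Gamma> \<tau> (decode_queries I v w) X \<alpha> \<beta> \<mu>"
proof -
  let ?\<iota> = "decode_queries I v w"
  note m = assms[unfolded mblp_feasible_def]
  have bin: "v \<kappa> i \<in> {0, 1}" "w \<kappa> i \<in> {0, 1}" if "i \<in> {1..I}" for \<kappa> i
    using m that by simp_all
  have sums: "(\<Sum>i=1..I. v \<kappa> i) = 1" "(\<Sum>i=1..I. w \<kappa> i) = 1" for \<kappa>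
    using m by simp_all
  have v: "decode_index I (v \<kappa>) \<in> {1..I}" for \<kappa>
    by (rule binary_sum_one_unit(1)[OF _ sums(1)], erule bin(1))
  have v_unit: "v \<kappa> i = of_bool (i = decode_index I (v \<kappa>))" if "i \<in> {1..I}" for \<kappa> i
    by (rule binary_sum_one_unit(2)[OF _ sums(1) that], erule bin(1))
  have w: "decode_index I (w \<kappa>) \<in> {1..I}" for \<kappa>
    by (rule binary_sum_one_unit(1)[OF _ sums(2)], erule bin(2))
  have w_unit: "w \<kappa> i = of_bool (i = decode_index I (w \<kappa>))" if "i \<in> {1..I}" for \<kappa> i
    by (rule binary_sum_one_unit(2)[OF _ sums(2) that], erule bin(2))
  \<comment> \<open>If the first index were not below the second, the tail of \<open>v\<close> from
    the second index on would contain the one of \<open>v\<close>, while the ordering constraint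
    bounds that tail by zero.\<close>
  have "decode_index I (v \<kappa>) < decode_index I (w \<kappa>)" for \<kappa>
  proof (rule ccontr)
    let ?j = "decode_index I (v \<kappa>)" and ?j' = "decode_index I (w \<kappa>)"
    assume "\<not> ?j < ?j'"
    then have "?j \<in> {?j'..I}" using v by simp
    moreover have "v \<kappa> i \<ge> 0" if "i \<in> {?j'..I}" for i using v_unit[of i] w[of \<kappa>] that by simp
    ultimately have "v \<kappa> ?j \<le> (\<Sum>i=?j'..I. v \<kappa> i)"
      by (intro member_le_sum) auto
    also have "\<dots> \<le> 1 - w \<kappa> ?j'" using m w by blast
    finally show False using v_unit[OF v] w_unit[OF w] by simp
  qed
  then have \<iota>: "?\<iota> \<in> queries I"
    using v w by (auto simp: queries_def comparisons_def decode_queries_def)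
  have vb: "vb s \<kappa> i = \<alpha> s $ \<kappa> * of_bool (i = fst (?\<iota> \<kappa>))"
    if "s \<in> sign_vectors" "i \<in> {1..I}" for s \<kappa> i
  proof -
    have "vb s \<kappa> i \<ge> 0 \<and> vb s \<kappa> i \<le> M * v \<kappa> i \<and> vb s \<kappa> i \<le> \<alpha> s $ \<kappa> \<and>
        vb s \<kappa> i \<ge> \<alpha> s $ \<kappa> - M * (1 - v \<kappa> i)"
      using m that by blast
    then show ?thesis using v_unit[OF that(2), of \<kappa>]
      by (cases "i = decode_index I (v \<kappa>)") (auto simp: decode_queries_def)
  qed
  have wb: "wb s \<kappa> i = \<alpha> s $ \<kappa> * of_bool (i = snd (?\<iota> \<kappa>))"
    if "s \<in> sign_vectors" "i \<in> {1..I}" for s \<kappa> i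
  proof -
    have "wb s \<kappa> i \<ge> 0 \<and> wb s \<kappa> i \<le> M * w \<kappa> i \<and> wb s \<kappa> i \<le> \<alpha> s $ \<kappa> \<and>
        wb s \<kappa> i \<ge> \<alpha> s $ \<kappa> - M * (1 - w \<kappa> i)"
      using m that by blast
    then show ?thesis using w_unit[OF that(2), of \<kappa>]
      by (cases "i = decode_index I (w \<kappa>)") (auto simp: decode_queries_def)
  qed
  show ?thesis
    unfolding fp_feasible_def
  proof (intro conjI ballI)
    fix s :: "real ^ 'k" assume s: "s \<in> sign_vectors"
    have "(\<Sum>i=1..I. (\<Sum>\<kappa>\<in>UNIV. s $ \<kappa> * (vb s \<kappa> i - wb s \<kappa> i)) *\<^sub>R x i)
        + transpose B *v \<beta> s = X s"
      using m s by blast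
    then show "(\<Sum>\<kappa>\<in>UNIV. (s $ \<kappa> * \<alpha> s $ \<kappa>) *\<^sub>R query_diff x ?\<iota> \<kappa>) + transpose B *v \<beta> s = X s"
      by (simp only: sum_unit_eq_query_diff[OF \<iota> vb[OF s] wb[OF s]])
  qed (use m \<iota> in blast)+
qed

text \<open>Here the size of \<open>M\<close> matters: \<open>\<alpha> s $ \<kappa> \<le> M\<close>
  gives the upper bound by \<open>M\<close> at a selected item, and makes the big-\<open>M\<close>
  lower bound nonpositive at all other items.\<close>

lemma fp_feasible_imp_mblp_feasible:
  fixes \<iota> :: "'k::finite \<Rightarrow> nat \<times> nat"
  assumes fp: "fp_feasible I x R B b \<Gamma> \<tau> \<iota> X \<alpha> \<beta> \<mu>"
    and M: "\<forall>s\<in>sign_vectors. \<forall>\<kappa>. \<alpha> s $ \<kappa> \<le> M"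
  shows "\<exists>v w vb wb. mblp_feasible I x R B b \<Gamma> M \<tau> v w \<alpha> \<beta> \<mu> X vb wb \<and> decode_queries I v w = \<iota>"
proof -
  define v w where "v \<kappa> i = (of_bool (i = fst (\<iota> \<kappa>)) :: real)"
    and "w \<kappa> i = (of_bool (i = snd (\<iota> \<kappa>)) :: real)" for \<kappa> i
  define vb wb where "vb s \<kappa> i = \<alpha> s $ \<kappa> * v \<kappa> i" and "wb s \<kappa> i = \<alpha> s $ \<kappa> * w \<kappa> i" for s \<kappa> i
  note f = fp[unfolded fp_feasible_def]
  have \<iota>: "\<iota> \<in> queries I" using f by blast
  have idx: "1 \<le> fst (\<iota> \<kappa>)" "fst (\<iota> \<kappa>) < snd (\<iota> \<kappa>)" "snd (\<iota> \<kappa>) \<le> I" for \<kappa>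
    using \<iota> by (auto simp: queries_def comparisons_def split_beta dest!: spec[of _ \<kappa>])
  have delta: "(\<Sum>i=l..I. of_bool (i = j)) = (of_bool (l \<le> j) :: real)" if "j \<le> I" for l j
  proof -
    have "(\<Sum>i=l..I. of_bool (i = j)) = (\<Sum>i=l..I. if i = j then 1 else 0 :: real)"
      by (rule sum.cong) auto
    also have "\<dots> = of_bool (l \<le> j)" using that by (subst sum.delta) auto
    finally show ?thesis .
  qed
  \<comment> \<open>Tail sums of \<open>v\<close> drop to zero just after
    \<open>fst (\<iota> \<kappa>)\<close>, so they have vanished at
    \<open>snd (\<iota> \<kappa>)\<close>, the one place where the ordering constraint demands
    it.\<close>
  have sums: "(\<Sum>i=l..I. v \<kappa> i) = of_bool (l \<le> fst (\<iota> \<kappa>))"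
    "(\<Sum>i=l..I. w \<kappa> i) = of_bool (l \<le> snd (\<iota> \<kappa>))" for l \<kappa>
    using idx[of \<kappa>] by (simp_all only: v_def w_def delta)
  have "mblp_feasible I x R B b \<Gamma> M \<tau> v w \<alpha> \<beta> \<mu> X vb wb"
    unfolding mblp_feasible_def
  proof (intro conjI ballI allI)
    fix s :: "real ^ 'k" assume s: "s \<in> sign_vectors"
    show "(\<Sum>i=1..I. (\<Sum>\<kappa>\<in>UNIV. s $ \<kappa> * (vb s \<kappa> i - wb s \<kappa> i)) *\<^sub>R x i) + transpose B *v \<beta> s = X s"
      unfolding vb_def wb_def v_def w_def sum_unit_eq_query_diff[OF \<iota> refl refl] using f s by blast
    fix \<kappa> i
    have "0 \<le> \<alpha> s $ \<kappa>" "\<alpha> s $ \<kappa> \<le> M" using f M s by (auto simp: less_eq_vec_def)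
    then show "vb s \<kappa> i \<ge> 0" "wb s \<kappa> i \<ge> 0" "vb s \<kappa> i \<le> M * v \<kappa> i" "vb s \<kappa> i \<le> \<alpha> s $ \<kappa>"
      "vb s \<kappa> i \<ge> \<alpha> s $ \<kappa> - M * (1 - v \<kappa> i)" "wb s \<kappa> i \<le> M * w \<kappa> i" "wb s \<kappa> i \<le> \<alpha> s $ \<kappa>"
      "wb s \<kappa> i \<ge> \<alpha> s $ \<kappa> - M * (1 - w \<kappa> i)"
      by (auto simp: vb_def wb_def v_def w_def)
  next
    fix \<kappa>
    show "(\<Sum>i=1..I. v \<kappa> i) = 1" "(\<Sum>i=1..I. w \<kappa> i) = 1"
      using idx[of \<kappa>] by (simp_all only: sums) simp_all
    fix i
    show "1 - w \<kappa> i \<ge> (\<Sum>i'=i..I. v \<kappa> i')"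
      unfolding sums using idx[of \<kappa>] by (simp add: w_def)
  qed (use f in \<open>auto simp: v_def w_def\<close>)
  moreover have "decode_queries I v w = \<iota>"
  proof
    fix \<kappa>
    have "decode_index I (\<lambda>i. of_bool (i = j)) = j" if "1 \<le> j" "j \<le> I" for j
    proof -
      have "decode_index I (\<lambda>i. of_bool (i = j)) = (\<Sum>i=1..I. if i = j then j else 0)"
        unfolding decode_index_def by (intro sum.cong) auto
      then show ?thesis using that by simp
    qed
    moreover have "v \<kappa> = (\<lambda>i. of_bool (i = fst (\<iota> \<kappa>)))" "w \<kappa> = (\<lambda>i. of_bool (i = snd (\<iota> \<kappa>)))"
      by (auto simp: v_def w_def)
    ultimately show "decode_queries I v w \<kappa> = \<iota> \<kappa>"
      using idx[of \<kappa>] by (simp add: decode_queries_def prod_eq_iff)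
  qed
  ultimately show ?thesis by blast
qed

section \<open>The elicitation problem\<close>

lemma required_noise_convex:
  assumes "0 \<le> t" "t \<le> 1"
  shows "required_noise x \<iota> s ((1 - t) *\<^sub>R u + t *\<^sub>R v) \<le>
    (1 - t) * required_noise x \<iota> s u + t * required_noise x \<iota> s v"
proof -
  have "max 0 (- (((1 - t) *\<^sub>R u + t *\<^sub>R v) \<bullet> d)) \<le>
      (1 - t) * max 0 (- (u \<bullet> d)) + t * max 0 (- (v \<bullet> d))" for d
  proof -
    have "(1 - t) * (- (u \<bullet> d)) \<le> (1 - t) * max 0 (- (u \<bullet> d))"
      "t * (- (v \<bullet> d)) \<le> t * max 0 (- (v \<bullet> d))"
      "0 \<le> (1 - t) * max 0 (- (u \<bullet> d))" "0 \<le> t * max 0 (- (v \<bullet> d))"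
      using assms by (intro mult_left_mono mult_nonneg_nonneg; simp)+
    then show ?thesis by (simp add: inner_add_left)
  qed
  then show ?thesis
    unfolding required_noise_def sum_distrib_left sum.distrib[symmetric] by (intro sum_mono)
qed

lemma convex_utility_set: "convex (utility_set B b)"
proof -
  have "b $ n \<le> (1 - t) * (B *v u) $ n + t * (B *v v) $ n"
    if "0 \<le> t" "t \<le> 1" "b \<le> B *v u" "b \<le> B *v v" for t u v n
  proof -
    have "(1 - t) * b $ n \<le> (1 - t) * (B *v u) $ n" "t * b $ n \<le> t * (B *v v) $ n"
      using that by (auto simp: less_eq_vec_def intro!: mult_left_mono)
    then show ?thesis by (simp add: algebra_simps)
  qed
  then show ?thesis
    unfolding convex_alt utility_set_def
    by (auto simp: less_eq_vec_def matrix_vector_right_distrib matrix_vector_mult_scaleR)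
qed

lemma convex_tolerant_utilities: "convex (tolerant_utilities x B b \<Gamma> \<iota> s)"
  unfolding convex_alt
proof (intro ballI allI impI)
  fix u v and t :: real
  assume uv: "u \<in> tolerant_utilities x B b \<Gamma> \<iota> s" "v \<in> tolerant_utilities x B b \<Gamma> \<iota> s"
    and t: "0 \<le> t \<and> t \<le> 1"
  have "required_noise x \<iota> s ((1 - t) *\<^sub>R u + t *\<^sub>R v) \<le>
      (1 - t) * required_noise x \<iota> s u + t * required_noise x \<iota> s v"
    using t by (intro required_noise_convex) auto
  also have "\<dots> \<le> \<Gamma>"
    using uv t by (intro convex_bound_le) (auto simp: tolerant_utilities_def)
  finally show "(1 - t) *\<^sub>R u + t *\<^sub>R v \<in> tolerant_utilities x B b \<Gamma> \<iota> s"
    using uv t convex_utility_set[of B b] by (auto simp: tolerant_utilities_def convex_alt)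
qed

section \<open>Comparison of response sets with their closed versions\<close>

lemma in_closure_of_segment:
  fixes p v :: "'a::real_normed_vector"
  assumes "\<And>t. 0 < t \<Longrightarrow> t \<le> 1 \<Longrightarrow> (1 - t) *\<^sub>R v + t *\<^sub>R p \<in> W"
  shows "v \<in> closure W"
proof -
  let ?f = "\<lambda>n. (1 - inverse (real (Suc n))) *\<^sub>R v + inverse (real (Suc n)) *\<^sub>R p"
  have "?f \<longlonglongrightarrow> (1 - 0) *\<^sub>R v + 0 *\<^sub>R p"
    by (intro tendsto_intros LIMSEQ_inverse_real_of_nat)
  then have "?f \<longlonglongrightarrow> v" by simp
  moreover have "?f n \<in> W" for n
    by (rule assms) (simp_all add: inverse_le_1_iff)
  ultimately show ?thesis unfolding closure_sequential by (intro exI[of _ ?f]) blast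
qed

text \<open>An indifferent answer satisfies the weak inequality of either sign, so zeros may be
  replaced by 1; any admissible \<epsilon> dominates the required noise coordinatewise.\<close>

lemma response_utilities_subset_tolerant:
  fixes s :: "real ^ 'k"
  assumes s: "s \<in> sign_zero_vectors"
  shows "\<exists>s'\<in>sign_vectors. response_utilities x B b \<Gamma> \<iota> s \<subseteq> tolerant_utilities x B b \<Gamma> \<iota> s'"
proof -
  define s' :: "real ^ 'k" where "s' = (\<chi> \<kappa>. if s $ \<kappa> = 0 then 1 else s $ \<kappa>)"
  have s_cases: "s $ \<kappa> = -1 \<or> s $ \<kappa> = 0 \<or> s $ \<kappa> = 1" for \<kappa>
    using s by (auto simp: sign_zero_vectors_def)
  have "s' \<in> sign_vectors" using s_cases by (force simp: sign_vectors_def s'_def)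
  moreover have "u \<in> tolerant_utilities x B b \<Gamma> \<iota> s'" if u: "u \<in> response_utilities x B b \<Gamma> \<iota> s" for u
  proof -
    obtain \<epsilon> where \<epsilon>: "\<epsilon> \<in> noise_set \<Gamma>" and c: "\<And>\<kappa>.
        (s $ \<kappa> = 1 \<longrightarrow> u \<bullet> query_diff x \<iota> \<kappa> > - (\<epsilon> $ \<kappa>)) \<and>
        (s $ \<kappa> = 0 \<longrightarrow> \<bar>u \<bullet> query_diff x \<iota> \<kappa>\<bar> \<le> \<epsilon> $ \<kappa>) \<and>
        (s $ \<kappa> = -1 \<longrightarrow> u \<bullet> query_diff x \<iota> \<kappa> < \<epsilon> $ \<kappa>)"
      using u unfolding response_utilities_def by blast
    have "max 0 (- (u \<bullet> (s' $ \<kappa> *\<^sub>R query_diff x \<iota> \<kappa>))) \<le> \<epsilon> $ \<kappa>" for \<kappa>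
    proof -
      have "0 \<le> \<epsilon> $ \<kappa>" using \<epsilon> by (auto simp: noise_set_def less_eq_vec_def)
      then show ?thesis using c[of \<kappa>] s_cases[of \<kappa>] by (auto simp: s'_def)
    qed
    then have "required_noise x \<iota> s' u \<le> (\<Sum>\<kappa>\<in>UNIV. \<epsilon> $ \<kappa>)"
      unfolding required_noise_def by (intro sum_mono)
    also have "\<dots> \<le> \<Gamma>" using \<epsilon> by (simp add: noise_set_def)
    finally show ?thesis
      using u by (simp add: tolerant_utilities_def response_utilities_def)
  qed
  ultimately show ?thesis by blast
qed

lemma sign_vectors_subset: "sign_vectors \<subseteq> sign_zero_vectors"
  by (auto simp: sign_vectors_def sign_zero_vectors_def)

lemma strict_tolerant_imp_response:
  fixes \<iota> :: "'k::finite \<Rightarrow> nat \<times> nat"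
  assumes s: "s \<in> sign_vectors" and u: "u \<in> utility_set B b" "required_noise x \<iota> s u < \<Gamma>"
  shows "u \<in> response_utilities x B b \<Gamma> \<iota> s"
proof -
  define l where "l \<kappa> = u \<bullet> (s $ \<kappa> *\<^sub>R query_diff x \<iota> \<kappa>)" for \<kappa>
  define \<delta> where "\<delta> = (\<Gamma> - required_noise x \<iota> s u) / real CARD('k)"
  have \<delta>: "\<delta> > 0" using u(2) by (simp add: \<delta>_def)
  define \<epsilon> where "\<epsilon> = (\<chi> \<kappa>. max 0 (- l \<kappa>) + \<delta>)"
  have "(\<Sum>\<kappa>\<in>UNIV. \<epsilon> $ \<kappa>) = \<Gamma>"
    by (simp add: \<epsilon>_def sum.distrib required_noise_def l_def \<delta>_def)
  then have "\<epsilon> \<in> noise_set \<Gamma>" using \<delta> by (simp add: noise_set_def less_eq_vec_def \<epsilon>_def)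
  moreover have "(s $ \<kappa> = 1 \<longrightarrow> u \<bullet> query_diff x \<iota> \<kappa> > - (\<epsilon> $ \<kappa>)) \<and>
        (s $ \<kappa> = 0 \<longrightarrow> \<bar>u \<bullet> query_diff x \<iota> \<kappa>\<bar> \<le> \<epsilon> $ \<kappa>) \<and>
        (s $ \<kappa> = -1 \<longrightarrow> u \<bullet> query_diff x \<iota> \<kappa> < \<epsilon> $ \<kappa>)" for \<kappa>
  proof -
    have "s $ \<kappa> = -1 \<or> s $ \<kappa> = 1" using s by (auto simp: sign_vectors_def)
    then show ?thesis using \<delta> by (auto simp: \<epsilon>_def l_def)
  qed
  ultimately show ?thesis using u(1) unfolding response_utilities_def by blast
qed

lemma tolerant_subset_closure_response:
  fixes \<iota> :: "'k::finite \<Rightarrow> nat \<times> nat"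
  assumes s: "s \<in> sign_vectors" and ne: "tolerant_utilities x B b \<Gamma> \<iota> s \<noteq> {}"
  shows "\<exists>s'\<in>consistent_responses x B b \<Gamma> \<iota>.
    tolerant_utilities x B b \<Gamma> \<iota> s \<subseteq> closure (response_utilities x B b \<Gamma> \<iota> s')"
proof (cases "\<exists>p\<in>utility_set B b. required_noise x \<iota> s p < \<Gamma>")
  case True
  then obtain p where p: "p \<in> utility_set B b" "required_noise x \<iota> s p < \<Gamma>" by blast
  \<comment> \<open>By convexity, the slack of \<open>p\<close> in the noise budget keeps the
    segment from \<open>p\<close> to \<open>u\<close>, except possibly \<open>u\<close> itself,
    strictly below \<Gamma>.\<close>
  have "u \<in> closure (response_utilities x B b \<Gamma> \<iota> s)"
    if u: "u \<in> tolerant_utilities x B b \<Gamma> \<iota> s" for u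
  proof (rule in_closure_of_segment[where p = p])
    fix t :: real assume t: "0 < t" "t \<le> 1"
    have "required_noise x \<iota> s ((1 - t) *\<^sub>R u + t *\<^sub>R p) \<le>
        (1 - t) * required_noise x \<iota> s u + t * required_noise x \<iota> s p"
      using t by (intro required_noise_convex) auto
    also have "\<dots> < (1 - t) * \<Gamma> + t * \<Gamma>"
      using t p(2) u
      by (intro add_le_less_mono mult_left_mono mult_strict_left_mono) (auto simp: tolerant_utilities_def)
    also have "\<dots> = \<Gamma>" by (simp add: algebra_simps)
    finally show "(1 - t) *\<^sub>R u + t *\<^sub>R p \<in> response_utilities x B b \<Gamma> \<iota> s"
      using u p(1) t convex_utility_set[of B b]
      by (intro strict_tolerant_imp_response[OF s]) (auto simp: tolerant_utilities_def convex_alt)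
  qed
  moreover have "s \<in> consistent_responses x B b \<Gamma> \<iota>"
    using strict_tolerant_imp_response[OF s p] s sign_vectors_subset
    by (auto simp: consistent_responses_def)
  ultimately show ?thesis by blast
next
  case False
  let ?F = "tolerant_utilities x B b \<Gamma> \<iota> s"
  define l where "l u \<kappa> = u \<bullet> (s $ \<kappa> *\<^sub>R query_diff x \<iota> \<kappa>)" for u \<kappa>
  have l_add: "l ((1 - t) *\<^sub>R u + t *\<^sub>R v) \<kappa> = (1 - t) * l u \<kappa> + t * l v \<kappa>" for t u v \<kappa>
    by (simp add: l_def inner_add_left algebra_simps)
  have noise: "required_noise x \<iota> s u = (\<Sum>\<kappa>\<in>UNIV. max 0 (- l u \<kappa>))" for u
    by (simp add: required_noise_def l_def)
  \<comment> \<open>The queries on which some tolerant utility strictly agrees with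
    \<open>s\<close>; these answers will be kept.\<close>
  define P where "P = {\<kappa>. \<exists>u\<in>?F. l u \<kappa> > 0}"
  \<comment> \<open>A sign change of \<open>l _ \<kappa>\<close> on \<open>?F\<close> would let the midpoint get by with strictly less noise.\<close>
  have nonneg: "l v \<kappa> \<ge> 0" if "\<kappa> \<in> P" and v: "v \<in> ?F" for \<kappa> v
  proof (rule ccontr)
    assume neg: "\<not> l v \<kappa> \<ge> 0"
    obtain u where u: "u \<in> ?F" "l u \<kappa> > 0" using \<open>\<kappa> \<in> P\<close> unfolding P_def by blast
    let ?m = "(1 - 1/2) *\<^sub>R u + (1/2) *\<^sub>R v"
    have "required_noise x \<iota> s ?m < (\<Sum>\<kappa>\<in>UNIV. (max 0 (- l u \<kappa>) + max 0 (- l v \<kappa>)) / 2)"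
      unfolding noise l_add
    proof (rule sum_strict_mono_ex1)
      show "\<exists>\<kappa>\<in>UNIV. max 0 (- ((1 - 1/2) * l u \<kappa> + 1/2 * l v \<kappa>))
          < (max 0 (- l u \<kappa>) + max 0 (- l v \<kappa>)) / 2"
        using neg u(2) by (intro bexI[of _ \<kappa>]) (auto simp: max_def)
    qed (auto simp: max_def)
    also have "\<dots> = (required_noise x \<iota> s u + required_noise x \<iota> s v) / 2"
      by (simp add: noise sum.distrib sum_divide_distrib[symmetric])
    also have "\<dots> \<le> \<Gamma>" using u v by (auto simp: tolerant_utilities_def)
    finally have "required_noise x \<iota> s ?m < \<Gamma>" .
    moreover have "?m \<in> utility_set B b"
      using u(1) v convexD[OF convex_utility_set[of B b], of u v "1 - 1/2" "1/2"]
      by (auto simp: tolerant_utilities_def)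
    ultimately show False using False by blast
  qed
  \<comment> \<open>Averaging one witness per query gives a single utility positive on all of
    \<open>P\<close>: by \<open>nonneg\<close> no summand is negative there, and the query's own
    witness contributes a positive one.\<close>
  obtain p where p: "p \<in> ?F" "\<And>\<kappa>. \<kappa> \<in> P \<Longrightarrow> l p \<kappa> > 0"
  proof -
    have "\<exists>u\<in>?F. \<kappa> \<in> P \<longrightarrow> l u \<kappa> > 0" for \<kappa>
      using ne unfolding P_def by blast
    then obtain w where w: "\<And>\<kappa>. w \<kappa> \<in> ?F" "\<And>\<kappa>. \<kappa> \<in> P \<Longrightarrow> l (w \<kappa>) \<kappa> > 0" by metis
    define c where "c = 1 / real CARD('k)"
    have c: "c > 0" by (simp add: c_def)
    define p where "p = (\<Sum>\<kappa>\<in>UNIV. c *\<^sub>R w \<kappa>)"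
    have "p \<in> ?F"
      unfolding p_def by (rule convex_sum[OF _ convex_tolerant_utilities]) (use w c in \<open>auto simp: c_def\<close>)
    moreover have "l p \<kappa> > 0" if "\<kappa> \<in> P" for \<kappa>
    proof -
      have "l p \<kappa> = (\<Sum>\<kappa>'\<in>UNIV. c * l (w \<kappa>') \<kappa>)"
        by (simp add: l_def p_def inner_sum_left sum_distrib_left mult.left_commute)
      also have "\<dots> > 0"
        by (rule sum_pos2[of _ \<kappa>]) (use w nonneg that c in auto)
      finally show ?thesis .
    qed
    ultimately show ?thesis by (rule that)
  qed
  \<comment> \<open>Outside \<open>P\<close> the answer is changed to indifference, whose constraint is not strict.\<close>
  define s' :: "real ^ 'k" where "s' = (\<chi> \<kappa>. if \<kappa> \<in> P then s $ \<kappa> else 0)"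
  have s_cases: "s $ \<kappa> = -1 \<or> s $ \<kappa> = 1" for \<kappa> using s by (auto simp: sign_vectors_def)
  have response: "u \<in> response_utilities x B b \<Gamma> \<iota> s'"
    if u: "u \<in> ?F" and pos: "\<And>\<kappa>. \<kappa> \<in> P \<Longrightarrow> l u \<kappa> > 0" for u
  proof -
    \<comment> \<open>On \<open>P\<close> strictness comes from \<open>l u \<kappa> > 0\<close>,
      with no noise spent; outside \<open>P\<close>, where \<open>l u \<kappa> \<le> 0\<close>, the
      noise is exactly the magnitude that indifference has to tolerate.\<close>
    define \<epsilon> where "\<epsilon> = (\<chi> \<kappa>. max 0 (- l u \<kappa>))"
    have "\<epsilon> \<in> noise_set \<Gamma>"
      using u by (simp add: noise_set_def less_eq_vec_def \<epsilon>_def tolerant_utilities_def noise)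
    moreover have "(s' $ \<kappa> = 1 \<longrightarrow> u \<bullet> query_diff x \<iota> \<kappa> > - (\<epsilon> $ \<kappa>)) \<and>
        (s' $ \<kappa> = 0 \<longrightarrow> \<bar>u \<bullet> query_diff x \<iota> \<kappa>\<bar> \<le> \<epsilon> $ \<kappa>) \<and>
        (s' $ \<kappa> = -1 \<longrightarrow> u \<bullet> query_diff x \<iota> \<kappa> < \<epsilon> $ \<kappa>)" for \<kappa>
    proof (cases "\<kappa> \<in> P")
      case True
      then show ?thesis using pos[OF True] s_cases[of \<kappa>] by (auto simp: s'_def \<epsilon>_def l_def)
    next
      case False
      then have "l u \<kappa> \<le> 0" using u unfolding P_def by force
      then show ?thesis using False s_cases[of \<kappa>] by (auto simp: s'_def \<epsilon>_def l_def)
    qed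
    ultimately show ?thesis using u unfolding response_utilities_def tolerant_utilities_def by blast
  qed
  have "s' \<in> sign_zero_vectors" using s_cases by (force simp: sign_zero_vectors_def s'_def)
  then have "s' \<in> consistent_responses x B b \<Gamma> \<iota>"
    using response[OF p] by (auto simp: consistent_responses_def)
  moreover have "u \<in> closure (response_utilities x B b \<Gamma> \<iota> s')" if u: "u \<in> ?F" for u
  proof (rule in_closure_of_segment[where p = p])
    fix t :: real assume t: "0 < t" "t \<le> 1"
    show "(1 - t) *\<^sub>R u + t *\<^sub>R p \<in> response_utilities x B b \<Gamma> \<iota> s'"
    proof (rule response)
      show "(1 - t) *\<^sub>R u + t *\<^sub>R p \<in> ?F"
        using convexD_alt[OF convex_tolerant_utilities u p(1)] t by simp
      show "l ((1 - t) *\<^sub>R u + t *\<^sub>R p) \<kappa> > 0" if "\<kappa> \<in> P" for \<kappa>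
        unfolding l_add using nonneg[OF that u] p(2)[OF that] t
        by (intro add_nonneg_pos mult_nonneg_nonneg mult_pos_pos) auto
    qed
  qed
  ultimately show ?thesis by blast
qed

text \<open>Lower bounds of a linear functional pass from a set to its closure, so response sets and
  closed sets impose the same bounds. A nonempty \<open>R\<close> provides a recommendation for the
  sign vectors whose closed set is empty.\<close>

lemma qp_value_at_eq_Sup_guaranteed:
  fixes \<iota> :: "'k::finite \<Rightarrow> nat \<times> nat"
  assumes R: "R \<noteq> {}"
  shows "qp_value_at x R B b \<Gamma> \<iota> = Sup {ereal \<tau> |\<tau>. guaranteed x R B b \<Gamma> \<iota> \<tau>}"
proof (rule antisym)
  show "Sup {ereal \<tau> |\<tau>. guaranteed x R B b \<Gamma> \<iota> \<tau>} \<le> qp_value_at x R B b \<Gamma> \<iota>"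
  proof (rule Sup_least)
    fix a assume "a \<in> {ereal \<tau> |\<tau>. guaranteed x R B b \<Gamma> \<iota> \<tau>}"
    then obtain \<tau> where a: "a = ereal \<tau>" and g: "guaranteed x R B b \<Gamma> \<iota> \<tau>" by blast
    show "a \<le> qp_value_at x R B b \<Gamma> \<iota>"
      unfolding a qp_value_at_def
    proof (rule INF_greatest)
      fix s assume "s \<in> consistent_responses x B b \<Gamma> \<iota>"
      then obtain s' where s': "s' \<in> sign_vectors"
        "response_utilities x B b \<Gamma> \<iota> s \<subseteq> tolerant_utilities x B b \<Gamma> \<iota> s'"
        using response_utilities_subset_tolerant unfolding consistent_responses_def by blast
      then obtain y where y: "y \<in> R" "\<forall>u\<in>response_utilities x B b \<Gamma> \<iota> s. \<tau> \<le> u \<bullet> y"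
        using g unfolding guaranteed_def by blast
      have "ereal \<tau> \<le> (INF u\<in>response_utilities x B b \<Gamma> \<iota> s. ereal (u \<bullet> y))"
        using y(2) by (auto intro: INF_greatest)
      then show "ereal \<tau> \<le> (SUP y\<in>R. INF u\<in>response_utilities x B b \<Gamma> \<iota> s. ereal (u \<bullet> y))"
        by (rule SUP_upper2[OF y(1)])
    qed
  qed
  show "qp_value_at x R B b \<Gamma> \<iota> \<le> Sup {ereal \<tau> |\<tau>. guaranteed x R B b \<Gamma> \<iota> \<tau>}"
  \<comment> \<open>Approaching the value strictly from below allows picking an actual
    recommendation \<open>y\<close> without the supremum over \<open>R\<close> being
    attained.\<close>
  proof (rule dense_le)
    fix a assume a: "a < qp_value_at x R B b \<Gamma> \<iota>"
    show "a \<le> Sup {ereal \<tau> |\<tau>. guaranteed x R B b \<Gamma> \<iota> \<tau>}"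
    proof (cases a)
      case (real \<tau>)
      have "\<exists>y\<in>R. \<forall>u\<in>tolerant_utilities x B b \<Gamma> \<iota> s. \<tau> \<le> u \<bullet> y" if s: "s \<in> sign_vectors" for s
      proof (cases "tolerant_utilities x B b \<Gamma> \<iota> s = {}")
        case True
        then show ?thesis using R by auto
      next
        case False
        then obtain s' where s': "s' \<in> consistent_responses x B b \<Gamma> \<iota>"
          "tolerant_utilities x B b \<Gamma> \<iota> s \<subseteq> closure (response_utilities x B b \<Gamma> \<iota> s')"
          using tolerant_subset_closure_response[OF s] by blast
        have "ereal \<tau> < (SUP y\<in>R. INF u\<in>response_utilities x B b \<Gamma> \<iota> s'. ereal (u \<bullet> y))"
          using a s'(1) unfolding real qp_value_at_def by (meson INF_lower less_le_trans)
        then obtain y where y: "y \<in> R"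
          "ereal \<tau> < (INF u\<in>response_utilities x B b \<Gamma> \<iota> s'. ereal (u \<bullet> y))"
          unfolding less_SUP_iff by blast
        have "\<tau> \<le> u \<bullet> y" if "u \<in> response_utilities x B b \<Gamma> \<iota> s'" for u
        proof -
          have "ereal \<tau> < ereal (u \<bullet> y)"
            using y(2) INF_lower[OF that, of "\<lambda>u. ereal (u \<bullet> y)"] by (rule less_le_trans)
          then show ?thesis by simp
        qed
        then have "response_utilities x B b \<Gamma> \<iota> s' \<subseteq> {u. y \<bullet> u \<ge> \<tau>}"
          by (auto simp: inner_commute)
        then have "closure (response_utilities x B b \<Gamma> \<iota> s') \<subseteq> {u. y \<bullet> u \<ge> \<tau>}"
          by (rule closure_minimal) (rule closed_halfspace_ge)
        then have "\<forall>u\<in>tolerant_utilities x B b \<Gamma> \<iota> s. \<tau> \<le> u \<bullet> y"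
          using s'(2) by (auto simp: inner_commute)
        then show ?thesis using y(1) by blast
      qed
      then have "guaranteed x R B b \<Gamma> \<iota> \<tau>" by (simp add: guaranteed_def)
      then show ?thesis unfolding real by (auto intro: Sup_upper)
    next
      case PInf
      with a show ?thesis by simp
    next
      case MInf
      then show ?thesis by simp
    qed
  qed
qed

section \<open>Equivalence of the programs and optimality of the decoded queries\<close>

theorem theorem2:
  fixes I :: nat and x :: "nat \<Rightarrow> real ^ 'j" and R :: "(real ^ 'j) set"
    and B :: "real ^ 'j ^ 'n" and b :: "real ^ 'n" and \<Gamma> :: real
  assumes "I \<ge> 2"
    and "\<Gamma> \<ge> 0"
    and "utility_set B b \<noteq> {}"
    and "aff_dim (utility_set B b) = int CARD('j)"
    and "bounded (utility_set B b)"
    and "discrete R"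
    and "mixed_binary_linear_representable R"
  shows "\<exists>M0::real. \<forall>M\<ge>M0.
    fp_value TYPE('k::finite) I x R B b \<Gamma> = mblp_value TYPE('k) I x R B b \<Gamma> M \<and>
    (fp_optimal_queries I x R B b \<Gamma> :: ('k \<Rightarrow> nat \<times> nat) set) = mblp_optimal_queries I x R B b \<Gamma> M \<and>
    (\<forall>\<tau> (v :: 'k \<Rightarrow> nat \<Rightarrow> real) w \<alpha> \<beta> \<mu> X vb wb.
       mblp_optimal I x R B b \<Gamma> M \<tau> v w \<alpha> \<beta> \<mu> X vb wb \<longrightarrow>
       decode_queries I v w \<in> qp_optimal_queries I x R B b \<Gamma>)"
proof -
  let ?F = "fp_feasible I x R B b \<Gamma>"
  have "finite R" using assms(6,7) by (rule discrete_representable_finite)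
  then obtain M0 where M0:
    "\<And>\<tau> (\<iota> :: 'k \<Rightarrow> nat \<times> nat). \<exists>X \<alpha> \<beta> \<mu>. ?F \<tau> \<iota> X \<alpha> \<beta> \<mu> \<Longrightarrow>
      \<exists>X \<alpha> \<beta> \<mu>. ?F \<tau> \<iota> X \<alpha> \<beta> \<mu> \<and> (\<forall>s\<in>sign_vectors. \<forall>\<kappa>. \<alpha> s $ \<kappa> \<le> M0)"
    using fp_multipliers_bounded[OF assms(3,5,2)] by metis
  \<comment> \<open>All values are expressed through the sets \<open>T \<iota>\<close> of values
    feasible for fixed queries, which are empty for inadmissible \<iota>.\<close>
  define T where "T \<iota> = {\<tau>. \<exists>X \<alpha> \<beta> \<mu>. ?F \<tau> \<iota> X \<alpha> \<beta> \<mu>}" for \<iota> :: "'k \<Rightarrow> nat \<times> nat"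
  have T: "\<tau> \<in> T \<iota> \<longleftrightarrow> \<iota> \<in> queries I \<and> guaranteed x R B b \<Gamma> \<iota> \<tau>" for \<tau> \<iota>
    unfolding T_def mem_Collect_eq by (rule ex_fp_feasible_iff[OF assms(3,5)])
  have fp_at: "fp_value_at I x R B b \<Gamma> \<iota> = Sup (ereal ` T \<iota>)" for \<iota>
    unfolding fp_value_at_def T_def by (intro arg_cong[where f = Sup]) blast
  have fp: "fp_value TYPE('k) I x R B b \<Gamma> = Sup (ereal ` (\<Union>\<iota>. T \<iota>))"
    unfolding fp_value_def T_def by (intro arg_cong[where f = Sup]) blast
  show ?thesis
  proof (intro exI[of _ M0] allI impI)
    fix M assume M: "M0 \<le> M"
    let ?G = "mblp_feasible I x R B b \<Gamma> M"
    have feasible_in_T: "\<tau> \<in> T (decode_queries I v w)" if "?G \<tau> v w \<alpha> \<beta> \<mu> X vb wb"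
      for \<tau> v w \<alpha> \<beta> \<mu> X vb wb
      using mblp_feasible_imp_fp_feasible[OF that] unfolding T_def by blast
    \<comment> \<open>Here \<open>M0 \<le> M\<close> enters: a solution with multipliers at most
      \<open>M0\<close> is chosen before it is translated.\<close>
    have T_feasible: "\<exists>v w \<alpha> \<beta> \<mu> X vb wb. ?G \<tau> v w \<alpha> \<beta> \<mu> X vb wb \<and> decode_queries I v w = \<iota>"
      if "\<tau> \<in> T \<iota>" for \<tau> \<iota>
    proof -
      have "\<exists>X \<alpha> \<beta> \<mu>. ?F \<tau> \<iota> X \<alpha> \<beta> \<mu>" using that by (simp add: T_def)
      from M0[OF this] obtain X \<alpha> \<beta> \<mu> where
        F: "?F \<tau> \<iota> X \<alpha> \<beta> \<mu>" and "\<forall>s\<in>sign_vectors. \<forall>\<kappa>. \<alpha> s $ \<kappa> \<le> M0"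
        by blast
      then have "\<forall>s\<in>sign_vectors. \<forall>\<kappa>. \<alpha> s $ \<kappa> \<le> M" using M order_trans by blast
      from fp_feasible_imp_mblp_feasible[OF F this] show ?thesis by blast
    qed
    have mblp_at_iff: "(\<exists>v w \<alpha> \<beta> \<mu> X vb wb. ?G \<tau> v w \<alpha> \<beta> \<mu> X vb wb \<and> decode_queries I v w = \<iota>)
        \<longleftrightarrow> \<tau> \<in> T \<iota>" for \<tau> \<iota>
      using feasible_in_T T_feasible by blast
    have mblp_iff: "(\<exists>(v :: 'k \<Rightarrow> nat \<Rightarrow> real) w \<alpha> \<beta> \<mu> X vb wb. ?G \<tau> v w \<alpha> \<beta> \<mu> X vb wb)
        \<longleftrightarrow> \<tau> \<in> (\<Union>\<iota>. T \<iota>)" for \<tau>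
    proof (intro iffI; elim exE UN_E)
      fix v :: "'k \<Rightarrow> nat \<Rightarrow> real" and w \<alpha> \<beta> \<mu> X vb wb
      assume "?G \<tau> v w \<alpha> \<beta> \<mu> X vb wb"
      from feasible_in_T[OF this] show "\<tau> \<in> (\<Union>\<iota>. T \<iota>)" by blast
    next
      fix \<iota> assume "\<tau> \<in> T \<iota>"
      from T_feasible[OF this]
      show "\<exists>(v :: 'k \<Rightarrow> nat \<Rightarrow> real) w \<alpha> \<beta> \<mu> X vb wb. ?G \<tau> v w \<alpha> \<beta> \<mu> X vb wb" by blast
    qed
    have mblp_at: "mblp_value_at I x R B b \<Gamma> M \<iota> = Sup (ereal ` T \<iota>)" for \<iota>
      unfolding mblp_value_at_def mblp_at_iff by (intro arg_cong[where f = Sup]) blast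
    have mblp: "mblp_value TYPE('k) I x R B b \<Gamma> M = Sup (ereal ` (\<Union>\<iota>. T \<iota>))"
      unfolding mblp_value_def mblp_iff by (intro arg_cong[where f = Sup]) blast
    have "fp_value TYPE('k) I x R B b \<Gamma> = mblp_value TYPE('k) I x R B b \<Gamma> M"
      by (simp only: fp mblp)
    moreover have "(fp_optimal_queries I x R B b \<Gamma> :: ('k \<Rightarrow> nat \<times> nat) set)
        = mblp_optimal_queries I x R B b \<Gamma> M"
      by (simp only: fp_optimal_queries_def mblp_optimal_queries_def optimal_queries_def
          fp_at mblp_at fp mblp)
    moreover have "decode_queries I v w \<in> qp_optimal_queries I x R B b \<Gamma>"
      if opt: "mblp_optimal I x R B b \<Gamma> M \<tau> v w \<alpha> \<beta> \<mu> X vb wb"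
      for \<tau> and v w :: "'k \<Rightarrow> nat \<Rightarrow> real" and \<alpha> \<beta> \<mu> X vb wb
    proof -
      let ?\<iota> = "decode_queries I v w"
      have in_T: "\<tau> \<in> T ?\<iota>"
        by (rule feasible_in_T[OF opt[unfolded mblp_optimal_def, THEN conjunct1]])
      have max: "\<tau>' \<le> \<tau>" if "\<tau>' \<in> T \<iota>" for \<tau>' \<iota>
        using opt T_feasible[OF that] unfolding mblp_optimal_def by blast
      \<comment> \<open>An optimal solution is feasible and so contains a recommendation for some
        sign vector; hence \<open>R\<close> is nonempty.\<close>
      have "(1 :: real ^ 'k) \<in> sign_vectors" by (simp add: sign_vectors_def)
      with in_T have "R \<noteq> {}" unfolding T guaranteed_def by blast
      then have qp_at: "qp_value_at x R B b \<Gamma> \<iota> = Sup (ereal ` T \<iota>)" if "\<iota> \<in> queries I" for \<iota>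
        using that unfolding qp_value_at_eq_Sup_guaranteed[OF \<open>R \<noteq> {}\<close>]
        by (intro arg_cong[where f = Sup]) (auto simp: T)
      have \<iota>: "?\<iota> \<in> queries I" using in_T T by blast
      have "qp_value_at x R B b \<Gamma> ?\<iota> = ereal \<tau>"
        unfolding qp_at[OF \<iota>] using in_T max by (intro antisym Sup_least Sup_upper) auto
      moreover have "qp_value_at x R B b \<Gamma> \<iota> \<le> ereal \<tau>" if "\<iota> \<in> queries I"
        for \<iota> :: "'k \<Rightarrow> nat \<times> nat"
        unfolding qp_at[OF that] using max by (intro Sup_least) auto
      ultimately have "qp_value TYPE('k) I x R B b \<Gamma> = qp_value_at x R B b \<Gamma> ?\<iota>"
        unfolding qp_value_def using \<iota> by (intro antisym SUP_least SUP_upper) auto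
      then show ?thesis
        using \<iota> by (simp add: qp_optimal_queries_def optimal_queries_def)
    qed
    ultimately show "fp_value TYPE('k) I x R B b \<Gamma> = mblp_value TYPE('k) I x R B b \<Gamma> M \<and>
      (fp_optimal_queries I x R B b \<Gamma> :: ('k \<Rightarrow> nat \<times> nat) set) = mblp_optimal_queries I x R B b \<Gamma> M \<and>
      (\<forall>\<tau> (v :: 'k \<Rightarrow> nat \<Rightarrow> real) w \<alpha> \<beta> \<mu> X vb wb.
         mblp_optimal I x R B b \<Gamma> M \<tau> v w \<alpha> \<beta> \<mu> X vb wb \<longrightarrow>
         decode_queries I v w \<in> qp_optimal_queries I x R B b \<Gamma>)"
      by blast
  qed
qed

end
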